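(* Let $n\ge2$. There is a constant $\varkappa\in(0,1)$ depending only on $n$ such that the following holds. Suppose $G\subset\mathbb{R}^n$ is a John domain with $\operatorname{diam}(G)\le4$ and with John constant $c_J$. If $0<\beta\le\varkappa c_J$, then the $\beta$-version $G_\beta$ of $G$ satisfies a $\beta/4$-quasihyperbolic boundary condition.
   Context: A domain is an open connected set. Quasihyperbolic distance in a domain $D$: for $x,y\in D$, $k_D(x,y)=\inf_\gamma\int_\gamma\frac{ds}{\operatorname{dist}(z,\partial D)}$, the infimum being over all rectifiable curves $\gamma$ joining $x$ to $y$ in $D$. A bounded domain $D$ satisfies a $\beta$-quasihyperbolic boundary condition, $\beta\in(0,1]$, if there exist a point $x_0\in D$ and a constant $c<\infty$ such that $k_D(x,x_0)\le\frac1\beta\log\frac{1}{\operatorname{dist}(x,\partial D)}+c$ for every $x\in D$. John domain: a bounded domain $G\subset\mathbb{R}^n$ is a John domain if there exist $x_0\in G$ and $c_J\in(0,1]$ such that every $x\in G$ can be joined to $x_0$ by a rectifiable curve $\gamma:[0,\ell(\gamma)]\to G$ parametrized by arc length with $\gamma(0)=x$, $\gamma(\ell(\gamma))=x_0$ and $\operatorname{dist}(\gamma(t),\partial G)\ge c_Jt$ for each $t\in[0,\ell(\gamma)]$. The point $x_0$ is called a John center and the largest such $c_J\in(0,1]$ is called the John constant of $G$. Whitney decomposition: for each domain $G$ a Whitney decomposition $\mathcal{W}_G$ (as constructed in Stein's book) is fixed: a family of closed dyadic cubes with pairwise disjoint interiors and union $G$, such that $\operatorname{diam}(Q)\le\operatorname{dist}(Q,\partial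 G)\le4\operatorname{diam}(Q)$ for each $Q\in\mathcal{W}_G$, and $\sum_{Q\in\mathcal{W}_G}\chi_{Q^*}\le12^n$ with $Q^*=\frac98Q$. $\beta$-version: let $\beta\in(0,1]$ and let $Q=\prod_{i=1}^n[x_i-\ell/2,x_i+\ell/2]$ be a closed cube with side length $\ell\le4$. Put - room: $R(Q)=\prod_{i=1}^n(x_i-\ell/8,x_i+\ell/8)$; - $\beta$-passage: $P_\beta(Q)=\Big(\prod_{i=1}^{n-1}(x_i-(\ell/8)^{1/\beta},x_i+(\ell/8)^{1/\beta})\Big)\times(x_n+\ell/8,\,x_n+\ell/8+(\ell/8)^{1/\beta})$; - long $\beta$-passage: $L_\beta(Q)=\Big(\prod_{i=1}^{n-1}(x_i-(\ell/8)^{1/\beta},x_i+(\ell/8)^{1/\beta})\Big)\times(x_n,x_n+\ell/2)$; - $\beta$-apartment: $A_\beta(Q)=L_\beta(Q)\cup\big(Q\setminus(\partial R(Q)\cup\partial P_\beta(Q))\big)$. The $\beta$-version of a John domain $G$ (with $\operatorname{diam}(G)\le4$) is the domain $G_\beta=\bigcup_{Q\in\mathcal{W}_G}A_\beta(Q)$. *)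

theory Defs
  imports "HOL-Analysis.Analysis"
begin

definition domain :: "'a::topological_space set \<Rightarrow> bool" where
  "domain D \<longleftrightarrow> open D \<and> connected D"

definition curve_length :: "(real \<Rightarrow> 'a::metric_space) \<Rightarrow> real \<Rightarrow> real \<Rightarrow> ennreal" where
  "curve_length \<gamma> a b =
     Sup {ennreal (\<Sum>i<m. dist (\<gamma> (t i)) (\<gamma> (t (Suc i)))) | (m::nat) (t::nat \<Rightarrow> real).
            t 0 = a \<and> t m = b \<and> (\<forall>i<m. t i \<le> t (Suc i))}"

definition rectifiable :: "(real \<Rightarrow> 'a::metric_space) \<Rightarrow> bool" where
  "rectifiable \<gamma> \<longleftrightarrow> path \<gamma> \<and> curve_length \<gamma> 0 1 < \<infinity>"

definition arc_length_parametrized :: "(real \<Rightarrow> 'a::metric_space) \<Rightarrow> real \<Rightarrow> bool" where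
  "arc_length_parametrized \<gamma> L \<longleftrightarrow>
     0 \<le> L \<and> continuous_on {0..L} \<gamma> \<and> (\<forall>t\<in>{0..L}. curve_length \<gamma> 0 t = ennreal t)"

text \<open>The arc length parametrization of a rectifiable path. The choice of the parameter \<open>t\<close> is
  immaterial: \<open>\<gamma>\<close> is constant between any two parameters with the same arc length.\<close>

definition arc_length_reparam :: "(real \<Rightarrow> 'a::metric_space) \<Rightarrow> real \<Rightarrow> 'a" where
  "arc_length_reparam \<gamma> s = \<gamma> (SOME t. t \<in> {0..1} \<and> curve_length \<gamma> 0 t = ennreal s)"

definition arc_length_integral :: "('a::metric_space \<Rightarrow> real) \<Rightarrow> (real \<Rightarrow> 'a) \<Rightarrow> real" where
  "arc_length_integral \<rho> \<gamma> =
     integral {0..enn2real (curve_length \<gamma> 0 1)} (\<lambda>s. \<rho> (arc_length_reparam \<gamma> s))"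

text \<open>Only meaningful for domains with nonempty boundary, since \<open>infdist z {} = 0\<close>.\<close>

definition qh_dist :: "'a::metric_space set \<Rightarrow> 'a \<Rightarrow> 'a \<Rightarrow> real" where
  "qh_dist D x y =
     Inf {arc_length_integral (\<lambda>z. 1 / infdist z (frontier D)) \<gamma> | \<gamma>.
            rectifiable \<gamma> \<and> path_image \<gamma> \<subseteq> D \<and> pathstart \<gamma> = x \<and> pathfinish \<gamma> = y}"

definition qh_boundary_condition :: "real \<Rightarrow> 'a::metric_space set \<Rightarrow> bool" where
  "qh_boundary_condition \<beta> D \<longleftrightarrow>
     domain D \<and> bounded D \<and> 0 < \<beta> \<and> \<beta> \<le> 1 \<and>
     (\<exists>x0\<in>D. \<exists>c. \<forall>x\<in>D. qh_dist D x x0 \<le> 1 / \<beta> * ln (1 / infdist x (frontier D)) + c)"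

definition john_condition :: "'a::metric_space set \<Rightarrow> 'a \<Rightarrow> real \<Rightarrow> bool" where
  "john_condition G x0 c \<longleftrightarrow>
     (\<forall>x\<in>G. \<exists>\<gamma> L. arc_length_parametrized \<gamma> L \<and> \<gamma> ` {0..L} \<subseteq> G \<and> \<gamma> 0 = x \<and> \<gamma> L = x0 \<and>
        (\<forall>t\<in>{0..L}. infdist (\<gamma> t) (frontier G) \<ge> c * t))"

definition john_domain :: "'a::metric_space set \<Rightarrow> bool" where
  "john_domain G \<longleftrightarrow>
     domain G \<and> bounded G \<and> (\<exists>x0\<in>G. \<exists>c. 0 < c \<and> c \<le> 1 \<and> john_condition G x0 c)"

definition is_john_constant :: "'a::metric_space set \<Rightarrow> real \<Rightarrow> bool" where
  "is_john_constant G c \<longleftrightarrow>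
     (0 < c \<and> c \<le> 1 \<and> (\<exists>x0\<in>G. john_condition G x0 c)) \<and>
     (\<forall>c'. 0 < c' \<and> c' \<le> 1 \<and> (\<exists>x0\<in>G. john_condition G x0 c') \<longrightarrow> c' \<le> c)"

definition cube :: "real ^ 'n \<Rightarrow> real \<Rightarrow> (real ^ 'n) set" where
  "cube x l = {z. \<forall>i. x $ i - l / 2 \<le> z $ i \<and> z $ i \<le> x $ i + l / 2}"

definition dyadic_cube :: "(real ^ 'n) set \<Rightarrow> bool" where
  "dyadic_cube Q \<longleftrightarrow>
     (\<exists>(k::int) (m::'n \<Rightarrow> int).
        Q = {z. \<forall>i. of_int (m i) * 2 powi k \<le> z $ i \<and> z $ i \<le> (of_int (m i) + 1) * 2 powi k})"

definition whitney_decomposition :: "(real ^ 'n) set \<Rightarrow> (real ^ 'n) set set \<Rightarrow> bool" where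
  "whitney_decomposition G W \<longleftrightarrow>
     (\<forall>Q\<in>W. dyadic_cube Q) \<and>
     pairwise (\<lambda>Q Q'. interior Q \<inter> interior Q' = {}) W \<and>
     \<Union>W = G \<and>
     (\<forall>Q\<in>W. diameter Q \<le> setdist Q (frontier G) \<and> setdist Q (frontier G) \<le> 4 * diameter Q) \<and>
     (\<forall>z. let S = {(x, l). 0 < l \<and> cube x l \<in> W \<and> z \<in> cube x (9 / 8 * l)}
          in finite S \<and> card S \<le> 12 ^ CARD('n))"

text \<open>The index of the distinguished last coordinate \<open>x\<^sub>n\<close>.\<close>

definition last_index :: "'n::{finite,linorder}" where
  "last_index = Max UNIV"

definition room :: "real ^ 'n \<Rightarrow> real \<Rightarrow> (real ^ 'n) set" where
  "room x l = {z. \<forall>i. x $ i - l / 8 < z $ i \<and> z $ i < x $ i + l / 8}"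

definition passage ::
    "real \<Rightarrow> real ^ 'n::{finite,linorder} \<Rightarrow> real \<Rightarrow> (real ^ 'n::{finite,linorder}) set" where
  "passage \<beta> x l =
     {z. (\<forall>i. i \<noteq> last_index \<longrightarrow>
            x $ i - (l / 8) powr (1 / \<beta>) < z $ i \<and> z $ i < x $ i + (l / 8) powr (1 / \<beta>)) \<and>
         x $ last_index + l / 8 < z $ last_index \<and>
         z $ last_index < x $ last_index + l / 8 + (l / 8) powr (1 / \<beta>)}"

definition long_passage ::
    "real \<Rightarrow> real ^ 'n::{finite,linorder} \<Rightarrow> real \<Rightarrow> (real ^ 'n::{finite,linorder}) set" where
  "long_passage \<beta> x l =
     {z. (\<forall>i. i \<noteq> last_index \<longrightarrow>
            x $ i - (l / 8) powr (1 / \<beta>) < z $ i \<and> z $ i < x $ i + (l / 8) powr (1 / \<beta>)) \<and>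
         x $ last_index < z $ last_index \<and>
         z $ last_index < x $ last_index + l / 2}"

definition apartment ::
    "real \<Rightarrow> real ^ 'n::{finite,linorder} \<Rightarrow> real \<Rightarrow> (real ^ 'n::{finite,linorder}) set" where
  "apartment \<beta> x l =
     long_passage \<beta> x l \<union> (cube x l - (frontier (room x l) \<union> frontier (passage \<beta> x l)))"

definition beta_version ::
    "real \<Rightarrow> (real ^ 'n::{finite,linorder}) set set \<Rightarrow> (real ^ 'n::{finite,linorder}) set" where
  "beta_version \<beta> W = \<Union>{apartment \<beta> x l | x l. 0 < l \<and> cube x l \<in> W}"

end

theory Submission
  imports Defs
begin

text \<open>The domain \<open>G\<^sub>\<beta>\<close> is \<open>G\<close> with the walls of all apartments removed. Near the boundary of a
  Whitney cube \<open>Q\<close> of side \<open>l\<close> the distance to \<open>\<partial>G\<^sub>\<beta>\<close> is comparable to \<open>l\<close>, so any two points of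
  \<open>\<partial>Q\<close> are at bounded quasihyperbolic distance. Discretising a John curve at times growing
  geometrically with ratio \<open>1 + O(c\<^sub>J)\<close> makes consecutive points lie in touching cubes, because
  disjoint dyadic cubes are at least the smaller side apart; moving along the boundaries of these
  cubes reaches the John center at cost \<open>O(1 / c\<^sub>J) log (1 / l) \<le> (1 / \<beta>) log (1 / l)\<close> up to constants.
  Inside \<open>Q\<close>, a point at distance \<open>d\<close> from \<open>\<partial>G\<^sub>\<beta>\<close> leaves the walls along a cone at cost
  \<open>O(log (l / d))\<close>, either to \<open>\<partial>Q\<close> or to the axis of the passage of width \<open>r = (l / 8)\<^bsup>1/\<beta>\<^esup>\<close>.
  Entering and leaving the passage along the axis costs at most \<open>3 / 2 log (l / r)\<close> each, which
  contributes \<open>(3 / \<beta>) log (1 / l)\<close>. The sum stays below \<open>(4 / \<beta>) log (1 / d)\<close> plus a constant.\<close>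

section \<open>Arc length and quasihyperbolic length\<close>

lemma sum_le_curve_length:
  assumes "t 0 = a" "t m = b" "\<And>i. i < m \<Longrightarrow> t i \<le> t (Suc i)"
  shows "ennreal (\<Sum>i<m. dist (g (t i)) (g (t (Suc i)))) \<le> curve_length g a b"
  unfolding curve_length_def using assms by (intro Sup_upper) blast

lemma curve_length_leI:
  assumes "\<And>m t. \<lbrakk>t 0 = a; t m = b; \<And>i. i < m \<Longrightarrow> t i \<le> t (Suc i)\<rbrakk>
    \<Longrightarrow> ennreal (\<Sum>i<m. dist (g (t i)) (g (t (Suc i)))) \<le> K"
  shows "curve_length g a b \<le> K"
  unfolding curve_length_def using assms by (intro Sup_least) auto

lemma partition_mono:
  fixes t :: "nat \<Rightarrow> real"
  assumes "\<And>i. i < m \<Longrightarrow> t i \<le> t (Suc i)" "i \<le> j" "j \<le> m"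
  shows "t i \<le> t j"
  using assms(2,3)
proof (induction j)
  case (Suc j)
  then show ?case
    using assms(1)[of j] by (cases "i = Suc j") auto
qed simp

lemma dist_le_curve_length:
  assumes "a \<le> b"
  shows "ennreal (dist (g a) (g b)) \<le> curve_length g a b"
  using sum_le_curve_length[of "\<lambda>i. if i = 0 then a else b" a 1 b g] assms by simp

lemma curve_length_le_lipschitz:
  assumes "1-lipschitz_on {a..b} g"
  shows "curve_length g a b \<le> ennreal (b - a)"
proof (rule curve_length_leI)
  fix m and t :: "nat \<Rightarrow> real"
  assume t: "t 0 = a" "t m = b" "\<And>i. i < m \<Longrightarrow> t i \<le> t (Suc i)"
  have "(\<Sum>i<m. dist (g (t i)) (g (t (Suc i)))) \<le> (\<Sum>i<m. t (Suc i) - t i)"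
  proof (rule sum_mono)
    fix i assume i: "i \<in> {..<m}"
    have "a \<le> t i" "t i \<le> t (Suc i)" "t (Suc i) \<le> b"
      using i t partition_mono[of m t 0 i] partition_mono[of m t "Suc i" m] by auto
    then show "dist (g (t i)) (g (t (Suc i))) \<le> t (Suc i) - t i"
      using lipschitz_onD[OF assms, of "t i" "t (Suc i)"] by (simp add: dist_real_def)
  qed
  also have "\<dots> = b - a"
    using t by (simp add: sum_lessThan_telescope)
  finally show "ennreal (\<Sum>i<m. dist (g (t i)) (g (t (Suc i)))) \<le> ennreal (b - a)"
    by (rule ennreal_leI)
qed

text \<open>Concatenating a partition of [a, b] with one of [b, c] gives a partition of [a, c]. The
  two suprema are then pulled out of the sum one after the other, which uses that both intervals
  have a partition.\<close>

lemma curve_length_superadditive: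
  assumes "a \<le> b" "b \<le> c"
  shows "curve_length g a b + curve_length g b c \<le> curve_length g a c"
proof -
  define A where "A a b = {ennreal (\<Sum>i<m. dist (g (t i)) (g (t (Suc i)))) | (m::nat) (t::nat \<Rightarrow> real).
            t 0 = a \<and> t m = b \<and> (\<forall>i<m. t i \<le> t (Suc i))}" for a b
  have V: "curve_length g a b = Sup (A a b)" for a b
    by (simp add: curve_length_def A_def)
  have ne: "A a b \<noteq> {}" if "a \<le> b" for a b
  proof -
    have "ennreal (\<Sum>i<Suc 0. dist (g ((\<lambda>i. if i = 0 then a else b) i)) (g ((\<lambda>i. if i = 0 then a else b) (Suc i)))) \<in> A a b"
      unfolding A_def using that
      by (intro CollectI exI[of _ "Suc 0"] exI[of _ "\<lambda>i. if i = 0 then a else b"]) auto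
    then show ?thesis by blast
  qed
  have split: "(\<Sum>i<m+m'. f i) = (\<Sum>i<m. f i) + (\<Sum>i<m'. f (m + i))" for f :: "nat \<Rightarrow> real" and m m'
    by (induction m') (auto simp: algebra_simps)
  have *: "x + y \<le> Sup (A a c)" if x: "x \<in> A a b" and y: "y \<in> A b c" for x y
  proof -
    obtain m t where t: "x = ennreal (\<Sum>i<m. dist (g (t i)) (g (t (Suc i))))"
      "t 0 = a" "t m = b" "\<forall>i<m. t i \<le> t (Suc i)"
      using x unfolding A_def by blast
    obtain m' t' where t': "y = ennreal (\<Sum>i<m'. dist (g (t' i)) (g (t' (Suc i))))"
      "t' 0 = b" "t' m' = c" "\<forall>i<m'. t' i \<le> t' (Suc i)"
      using y unfolding A_def by blast
    \<comment> \<open>The partitions share the point b: at index m both descriptions agree because t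
      m = t' 0.\<close>
    define u where "u i = (if i \<le> m then t i else t' (i - m))" for i
    have u1: "u i = t i" if "i \<le> m" for i using that by (simp add: u_def)
    have u2: "u (m + i) = t' i" for i using t t' by (simp add: u_def)
    have u3: "u (Suc (m + i)) = t' (Suc i)" for i by (simp add: u_def)
    have s: "(\<Sum>i<m+m'. dist (g (u i)) (g (u (Suc i)))) =
        (\<Sum>i<m. dist (g (t i)) (g (t (Suc i)))) + (\<Sum>i<m'. dist (g (t' i)) (g (t' (Suc i))))"
      unfolding split by (simp add: u1 u2 u3)
    have "u i \<le> u (Suc i)" if "i < m + m'" for i
    proof (cases "i < m")
      case True
      then show ?thesis using t(4) u1 by auto
    next
      case False
      then obtain j where "i = m + j" "j < m'"
        using \<open>i < m + m'\<close> by (metis add_less_cancel_left le_iff_add linorder_not_le)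
      then show ?thesis using t'(4) u2 u3 by simp
    qed
    then have "ennreal (\<Sum>i<m+m'. dist (g (u i)) (g (u (Suc i)))) \<le> curve_length g a c"
      using u1[of 0] u2[of m'] t(2) t'(3) by (intro sum_le_curve_length) auto
    then show ?thesis
      unfolding V s t(1) t'(1) by (simp add: sum_nonneg)
  qed
  have add: "Sup S + y = (SUP x\<in>S. x + y)" if "S \<noteq> {}" for S and y :: ennreal
    using ennreal_SUP_add_left[OF that, of "\<lambda>x. x" y] by simp
  have "Sup (A a b) + y \<le> Sup (A a c)" if "y \<in> A b c" for y
    unfolding add[OF ne[OF assms(1)]] using *[OF _ that] by (intro SUP_least)
  then have "Sup (A b c) + Sup (A a b) \<le> Sup (A a c)"
    unfolding add[OF ne[OF assms(2)]] by (intro SUP_least) (simp add: add.commute)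
  then show ?thesis
    unfolding V by (simp add: add.commute)
qed

text \<open>The length up to s is exactly s, so superadditivity bounds s + dist (g s) (g t) by the
  length up to t, which is t.\<close>

lemma arc_length_parametrized_lipschitz:
  assumes "arc_length_parametrized g L"
  shows "1-lipschitz_on {0..L} g"
proof -
  have *: "dist (g s) (g t) \<le> t - s" if "0 \<le> s" "s \<le> t" "t \<le> L" for s t
  proof -
    have "ennreal (s + dist (g s) (g t)) = curve_length g 0 s + ennreal (dist (g s) (g t))"
      using assms that by (simp add: arc_length_parametrized_def)
    also have "\<dots> \<le> curve_length g 0 s + curve_length g s t"
      using that by (intro add_left_mono dist_le_curve_length)
    also have "\<dots> \<le> curve_length g 0 t"
      using that by (intro curve_length_superadditive)
    also have "\<dots> = ennreal t"
      using assms that by (simp add: arc_length_parametrized_def)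
    finally show ?thesis using that by (simp flip: ennreal_plus)
  qed
  show ?thesis
  proof (rule lipschitz_onI)
    fix s t assume "s \<in> {0..L}" "t \<in> {0..L}"
    then show "dist (g s) (g t) \<le> 1 * dist s t"
      using *[of s t] *[of t s] by (cases "s \<le> t") (auto simp: dist_real_def dist_commute)
  qed simp
qed

text \<open>A 1-Lipschitz curve has length at most t on [0, t], so only the lower bound on its
  length has to be checked.\<close>

lemma arc_length_parametrizedI:
  assumes "0 \<le> L" "1-lipschitz_on {0..L} g" "\<And>t. t \<in> {0..L} \<Longrightarrow> ennreal t \<le> curve_length g 0 t"
  shows "arc_length_parametrized g L"
  unfolding arc_length_parametrized_def
proof (intro conjI ballI assms antisym)
  show "continuous_on {0..L} g"
    using assms(2) by (rule lipschitz_on_continuous_on)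
  fix t assume "t \<in> {0..L}"
  then show "curve_length g 0 t \<le> ennreal t"
    using curve_length_le_lipschitz[of 0 t g] lipschitz_on_subset[OF assms(2), of "{0..t}"] by auto
qed

lemma curve_length_cong:
  assumes "\<And>t. t \<in> {a..b} \<Longrightarrow> f t = g t"
  shows "curve_length f a b = curve_length g a b"
proof -
  have "curve_length f a b \<le> curve_length g a b"
    if "\<And>t. t \<in> {a..b} \<Longrightarrow> f t = g t" for f g :: "real \<Rightarrow> 'a"
  proof (rule curve_length_leI)
    fix m and t :: "nat \<Rightarrow> real"
    assume t: "t 0 = a" "t m = b" "\<And>i. i < m \<Longrightarrow> t i \<le> t (Suc i)"
    have "t i \<in> {a..b}" if "i \<le> m" for i
      using partition_mono[of m t 0 i] partition_mono[of m t i m] t that by auto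
    then have "(\<Sum>i<m. dist (f (t i)) (f (t (Suc i)))) = (\<Sum>i<m. dist (g (t i)) (g (t (Suc i))))"
      using that by (intro sum.cong) auto
    then show "ennreal (\<Sum>i<m. dist (f (t i)) (f (t (Suc i)))) \<le> curve_length g a b"
      using sum_le_curve_length[of t a m b g] t by simp
  qed
  from this[of f g] this[of g f] assms show ?thesis by (simp add: antisym)
qed

lemma curve_length_affine:
  assumes "k > 0"
  shows "curve_length (\<lambda>t. g (k * t + d)) a b = curve_length g (k * a + d) (k * b + d)"
proof (rule antisym)
  show "curve_length (\<lambda>t. g (k * t + d)) a b \<le> curve_length g (k * a + d) (k * b + d)"
  proof (rule curve_length_leI)
    fix m and t :: "nat \<Rightarrow> real"
    assume t: "t 0 = a" "t m = b" "\<And>i. i < m \<Longrightarrow> t i \<le> t (Suc i)"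
    show "ennreal (\<Sum>i<m. dist (g (k * t i + d)) (g (k * t (Suc i) + d)))
      \<le> curve_length g (k * a + d) (k * b + d)"
      using t assms by (intro sum_le_curve_length[of "\<lambda>i. k * t i + d"]) auto
  qed
  show "curve_length g (k * a + d) (k * b + d) \<le> curve_length (\<lambda>t. g (k * t + d)) a b"
  proof (rule curve_length_leI)
    fix m and t :: "nat \<Rightarrow> real"
    assume t: "t 0 = k * a + d" "t m = k * b + d" "\<And>i. i < m \<Longrightarrow> t i \<le> t (Suc i)"
    show "ennreal (\<Sum>i<m. dist (g (t i)) (g (t (Suc i)))) \<le> curve_length (\<lambda>t. g (k * t + d)) a b"
      using sum_le_curve_length[of "\<lambda>i. (t i - d) / k" a m b "\<lambda>t. g (k * t + d)"] t assms
      by (simp add: field_simps)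
  qed
qed

text \<open>The Lipschitz bound passes the junction by the triangle inequality; the lower bound on
  the length is superadditivity at the parameter L.\<close>

lemma arc_length_parametrized_join:
  assumes g: "arc_length_parametrized g L" and h: "arc_length_parametrized h M" and eq: "g L = h 0"
  shows "arc_length_parametrized (\<lambda>t. if t \<le> L then g t else h (t - L)) (L + M)" (is "arc_length_parametrized ?j _")
proof (rule arc_length_parametrizedI)
  have L: "0 \<le> L" "0 \<le> M" using g h by (auto simp: arc_length_parametrized_def)
  show "0 \<le> L + M" using L by simp
  have j1: "?j t = g t" if "t \<le> L" for t using that by simp
  have j2: "?j t = h (t - L)" if "t \<ge> L" for t using that eq by auto
  have l1: "dist (g s) (g t) \<le> t - s" if "0 \<le> s" "s \<le> t" "t \<le> L" for s t
    using lipschitz_onD[OF arc_length_parametrized_lipschitz[OF g], of s t] that by (auto simp: dist_real_def)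
  have l2: "dist (h s) (h t) \<le> t - s" if "0 \<le> s" "s \<le> t" "t \<le> M" for s t
    using lipschitz_onD[OF arc_length_parametrized_lipschitz[OF h], of s t] that by (auto simp: dist_real_def)
  have *: "dist (?j s) (?j t) \<le> t - s" if st: "0 \<le> s" "s \<le> t" "t \<le> L + M" for s t
  proof -
    consider "t \<le> L" | "s \<ge> L" | "s \<le> L" "t \<ge> L" by linarith
    then show ?thesis
    proof cases
      case 1
      then show ?thesis using l1[of s t] st by (simp add: j1)
    next
      case 2
      then show ?thesis using l2[of "s - L" "t - L"] st j2[of s] j2[of t] by simp
    next
      case 3
      have "dist (?j s) (?j t) \<le> dist (g s) (g L) + dist (h 0) (h (t - L))"
        using dist_triangle[of "?j s" "?j t" "g L"] j1[of s] j2[of t] eq 3 by simp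
      then show ?thesis using l1[of s L] l2[of 0 "t - L"] st 3 by simp
    qed
  qed
  show "1-lipschitz_on {0..L+M} ?j"
  proof (rule lipschitz_onI)
    fix s t assume "s \<in> {0..L+M}" "t \<in> {0..L+M}"
    then have "dist (?j s) (?j t) \<le> \<bar>s - t\<bar>"
      using *[of s t] *[of t s] dist_commute[of "?j s" "?j t"] by (smt (verit) atLeastAtMost_iff)
    then show "dist (?j s) (?j t) \<le> 1 * dist s t" by (simp only: dist_real_def mult_1)
  qed simp
  fix t assume t: "t \<in> {0..L+M}"
  have c1: "curve_length ?j 0 s = ennreal s" if "0 \<le> s" "s \<le> L" for s
    using curve_length_cong[of 0 s ?j g] g that by (auto simp: arc_length_parametrized_def)
  show "ennreal t \<le> curve_length ?j 0 t"
  proof (cases "t \<le> L")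
    case True
    then show ?thesis using c1[of t] t by simp
  next
    case False
    have "curve_length ?j L t = curve_length (\<lambda>t. h (1 * t + - L)) L t"
      using j2 eq by (intro curve_length_cong) auto
    also have "\<dots> = ennreal (t - L)"
      using h t False curve_length_affine[of 1 h "- L" L t] by (auto simp: arc_length_parametrized_def)
    finally have "ennreal t = curve_length ?j 0 L + curve_length ?j L t"
      using c1[of L] L False by (simp flip: ennreal_plus)
    also have "\<dots> \<le> curve_length ?j 0 t"
      using False L by (intro curve_length_superadditive) auto
    finally show ?thesis .
  qed
qed

lemma arc_length_parametrized_segment:
  fixes x v :: "'a::real_normed_vector"
  assumes "0 \<le> L" "norm v = 1"
  shows "arc_length_parametrized (\<lambda>t. x + t *\<^sub>R v) L"
proof (rule arc_length_parametrizedI)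
  have d: "dist (x + s *\<^sub>R v) (x + t *\<^sub>R v) = dist s t" for s t
    using assms(2) by (simp add: dist_norm flip: scaleR_diff_left)
  then show "1-lipschitz_on {0..L} (\<lambda>t. x + t *\<^sub>R v)"
    by (auto intro: lipschitz_onI)
  fix t assume "t \<in> {0..L}"
  then show "ennreal t \<le> curve_length (\<lambda>t. x + t *\<^sub>R v) 0 t"
    using dist_le_curve_length[of 0 t "\<lambda>t. x + t *\<^sub>R v"] assms(2) by (simp add: dist_norm)
qed fact

text \<open>An upper bound for \<open>qh_dist\<close> witnessed by an actual curve. Such bounds
  chain by concatenation, the curves also yield connectedness, and \<open>has_integral\<close>
  certifies a true integral instead of the default 0 of \<open>integral\<close>.\<close>

definition qh_joined :: "'a::metric_space set \<Rightarrow> real \<Rightarrow> 'a \<Rightarrow> 'a \<Rightarrow> bool" where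
  "qh_joined D K x y \<longleftrightarrow>
     (\<exists>g L I. arc_length_parametrized g L \<and> g ` {0..L} \<subseteq> D \<and> g 0 = x \<and> g L = y \<and>
        ((\<lambda>s. 1 / infdist (g s) (frontier D)) has_integral I) {0..L} \<and> I \<le> K)"

lemma qh_joined_mono: "qh_joined D K x y \<Longrightarrow> K \<le> K' \<Longrightarrow> qh_joined D K' x y"
  unfolding qh_joined_def using order_trans by blast

lemma qh_joined_trans:
  assumes "qh_joined D K x y" "qh_joined D K' y z"
  shows "qh_joined D (K + K') x z"
proof -
  let ?\<rho> = "\<lambda>z. 1 / infdist z (frontier D)"
  obtain g L I where g: "arc_length_parametrized g L" "g ` {0..L} \<subseteq> D" "g 0 = x" "g L = y"
    "((\<lambda>s. ?\<rho> (g s)) has_integral I) {0..L}" "I \<le> K"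
    using assms(1) unfolding qh_joined_def by auto
  obtain h M J where h: "arc_length_parametrized h M" "h ` {0..M} \<subseteq> D" "h 0 = y" "h M = z"
    "((\<lambda>s. ?\<rho> (h s)) has_integral J) {0..M}" "J \<le> K'"
    using assms(2) unfolding qh_joined_def by auto
  have L: "0 \<le> L" "0 \<le> M" using g h by (auto simp: arc_length_parametrized_def)
  define j where "j t = (if t \<le> L then g t else h (t - L))" for t
  have j2: "j t = h (t - L)" if "t \<ge> L" for t using that g(4) h(3) by (auto simp: j_def)
  have 1: "arc_length_parametrized j (L + M)"
    unfolding j_def using arc_length_parametrized_join[OF g(1) h(1)] g h by simp
  have 2: "((\<lambda>s. ?\<rho> (j s)) has_integral I) {0..L}"
    by (rule has_integral_eq[OF _ g(5)]) (simp add: j_def)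
  \<comment> \<open>Translating the parameter by L moves h onto [L, L + M] and leaves the integral
    unchanged.\<close>
  have "((\<lambda>s. ?\<rho> (h (1 *\<^sub>R s + - L))) has_integral (1 / \<bar>1\<bar> ^ DIM(real)) *\<^sub>R J) ((\<lambda>s. (1/1) *\<^sub>R s + - ((1/1) *\<^sub>R - L)) ` cbox 0 M)"
    using h(5) by (intro has_integral_affinity) auto
  moreover have "(\<lambda>s. (1/1) *\<^sub>R s + - ((1/1) *\<^sub>R - L)) ` cbox 0 M = {L..L+M}"
    by (simp add: image_add_atLeastAtMost' add.commute)
  ultimately have "((\<lambda>s. ?\<rho> (h (s - L))) has_integral J) {L..L+M}" by (simp add: add.commute)
  then have "((\<lambda>s. ?\<rho> (j s)) has_integral J) {L..L+M}"
    by (rule has_integral_eq[rotated]) (simp add: j2)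
  with 2 have 3: "((\<lambda>s. ?\<rho> (j s)) has_integral (I + J)) {0..L+M}"
    using L by (intro has_integral_combine[of 0 L]) auto
  have "j ` {0..L+M} \<subseteq> D"
    using g(2) h(2) by (auto simp: j_def image_subset_iff)
  moreover have "j 0 = x" "j (L + M) = z"
    using L g h j2[of "L + M"] by (auto simp: j_def)
  ultimately show ?thesis
    unfolding qh_joined_def using 1 3 g(6) h(6)
    by (intro exI[of _ j] exI[of _ "L + M"] exI[of _ "I + J"]) auto
qed

text \<open>If the density is not integrable along the curve, \<open>integral\<close> is 0 by
  default. The bound makes the set under the infimum in \<open>qh_dist\<close> bounded
  below.\<close>

lemma arc_length_integral_inverse_infdist_nonneg:
  "0 \<le> arc_length_integral (\<lambda>z. 1 / infdist z S) \<gamma>"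
  unfolding arc_length_integral_def
  by (cases "(\<lambda>s. 1 / infdist (arc_length_reparam \<gamma> s) S) integrable_on {0..enn2real (curve_length \<gamma> 0 1)}")
    (auto intro!: integral_nonneg simp: infdist_nonneg not_integrable_integral)

text \<open>Rescaling to \<gamma> t = g (L t) gives a path on [0, 1] whose length up to t is L t.
  Its arc length reparametrization is g again, so its integral is I.\<close>

lemma qh_joined_imp_qh_dist_le:
  assumes "qh_joined D K x y"
  shows "qh_dist D x y \<le> K"
proof -
  let ?\<rho> = "\<lambda>z. 1 / infdist z (frontier D)"
  obtain g L I where g: "arc_length_parametrized g L" "g ` {0..L} \<subseteq> D" "g 0 = x" "g L = y"
    "((\<lambda>s. ?\<rho> (g s)) has_integral I) {0..L}" "I \<le> K"
    using assms unfolding qh_joined_def by auto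
  have L: "0 \<le> L" and cont: "continuous_on {0..L} g"
    and len: "\<And>t. t \<in> {0..L} \<Longrightarrow> curve_length g 0 t = ennreal t"
    using g by (auto simp: arc_length_parametrized_def)
  define \<gamma> where "\<gamma> t = g (L * t)" for t
  have mem: "L * t \<in> {0..L}" if "t \<in> {0..1}" for t
    using that L by (auto simp: mult_left_le)
  have V: "curve_length \<gamma> 0 t = ennreal (L * t)" if t: "t \<in> {0..1}" for t
  proof (cases "L = 0")
    case True
    then have "curve_length \<gamma> 0 t \<le> 0"
      by (intro curve_length_leI) (auto simp: \<gamma>_def)
    then show ?thesis using True by simp
  next
    case False
    then show ?thesis
      using curve_length_affine[of L g 0 0 t] len[OF mem[OF t]] L by (simp add: \<gamma>_def[abs_def])
  qed
  have "path \<gamma>"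
    unfolding path_def \<gamma>_def[abs_def] using mem
    by (intro continuous_on_compose2[OF cont] continuous_intros) auto
  then have "rectifiable \<gamma>"
    using V[of 1] by (simp add: rectifiable_def)
  moreover have "path_image \<gamma> \<subseteq> D"
    using g(2) mem by (auto simp: path_image_def \<gamma>_def image_subset_iff)
  moreover have "pathstart \<gamma> = x" "pathfinish \<gamma> = y"
    using g by (auto simp: pathstart_def pathfinish_def \<gamma>_def)
  moreover have "arc_length_integral ?\<rho> \<gamma> = I"
  proof (cases "L = 0")
    case True
    then show ?thesis using g(5) V[of 1] by (auto simp: arc_length_integral_def has_integral_iff)
  next
    case False
    \<comment> \<open>For L > 0 the length L t determines t, so \<open>SOME\<close> can only return
      s / L.\<close>
    have "arc_length_reparam \<gamma> s = g s" if s: "s \<in> {0..L}" for s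
    proof -
      have "\<exists>t. t \<in> {0..1} \<and> curve_length \<gamma> 0 t = ennreal s"
        using V[of "s / L"] s L False by (intro exI[of _ "s / L"]) auto
      from someI_ex[OF this] show ?thesis
        unfolding arc_length_reparam_def using V s L
        by (auto simp: \<gamma>_def mult_nonneg_nonneg)
    qed
    then have "((\<lambda>s. ?\<rho> (arc_length_reparam \<gamma> s)) has_integral I) {0..L}"
      by (intro has_integral_eq[OF _ g(5)]) simp
    then show ?thesis
      using V[of 1] L by (simp add: arc_length_integral_def integral_unique)
  qed
  ultimately have "qh_dist D x y \<le> I"
    unfolding qh_dist_def
    by (intro cInf_lower bdd_belowI[of _ 0])
      (use arc_length_integral_inverse_infdist_nonneg in auto)
  with g(6) show ?thesis by simp
qed

lemma connected_if_qh_joined: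
  assumes "\<And>x. x \<in> D \<Longrightarrow> \<exists>K. qh_joined D K x b"
  shows "connected D"
proof -
  have *: "connected_component D x b" if x: "x \<in> D" for x
  proof -
    obtain g L where g: "arc_length_parametrized g L" "g ` {0..L} \<subseteq> D" "g 0 = x" "g L = b"
      using assms[OF x] unfolding qh_joined_def by auto
    then have "connected (g ` {0..L})" "0 \<le> L"
      by (auto simp: arc_length_parametrized_def intro!: connected_continuous_image)
    then show ?thesis
      unfolding connected_component_def using g by (intro exI[of _ "g ` {0..L}"]) auto
  qed
  then show ?thesis
    by (meson connected_iff_connected_component connected_component_sym connected_component_trans)
qed

text \<open>The density along a segment is dominated by a function of arc length with known
  integral. This reduces cost estimates to lower bounds for the distance to the boundary.\<close>

lemma qh_joined_segment:
  fixes x y :: "'a::euclidean_space"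
  assumes "open D" "frontier D \<noteq> {}" and seg: "\<And>\<tau>. \<tau> \<in> {0..1} \<Longrightarrow> x + \<tau> *\<^sub>R (y - x) \<in> D"
    and bound: "\<And>\<tau>. \<tau> \<in> {0..1} \<Longrightarrow> 1 / infdist (x + \<tau> *\<^sub>R (y - x)) (frontier D) \<le> \<phi> (\<tau> * dist x y)"
    and int: "(\<phi> has_integral K) {0..dist x y}"
  shows "qh_joined D K x y"
proof (cases "x = y")
  case True
  have "((\<lambda>s. 1 / infdist x (frontier D)) has_integral 0) {0..0::real}"
    using has_integral_refl(1)[of _ "0::real"] by simp
  moreover have "arc_length_parametrized (\<lambda>t. x) 0"
    by (intro arc_length_parametrizedI) (auto intro: lipschitz_onI)
  moreover have "K = 0" using int True by (auto simp: has_integral_iff)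
  ultimately show ?thesis
    unfolding qh_joined_def using seg[of 0] True by (intro exI[of _ "\<lambda>t. x"] exI[of _ 0]) auto
next
  case False
  define L where "L = dist x y"
  have L: "L > 0" using False by (simp add: L_def)
  define v where "v = (1 / L) *\<^sub>R (y - x)"
  have v: "norm v = 1" using L by (simp add: v_def L_def dist_norm norm_minus_commute)
  define g where "g t = x + t *\<^sub>R v" for t
  have g: "g t = x + (t / L) *\<^sub>R (y - x)" for t by (simp add: g_def v_def)
  have param: "arc_length_parametrized g L"
    unfolding g_def[abs_def] using L v by (intro arc_length_parametrized_segment) auto
  have mem: "g t \<in> D" if "t \<in> {0..L}" for t
    unfolding g using that L by (intro seg) auto
  \<comment> \<open>An open set does not meet its frontier, so the density is continuous along the
    segment and hence integrable.\<close>
  have pos: "infdist z (frontier D) \<noteq> 0" if "z \<in> D" for z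
    using that assms(1,2) by (metis disjoint_iff frontier_closed frontier_disjoint_eq in_closed_iff_infdist_zero)
  have "continuous_on {0..L} (\<lambda>s. 1 / infdist (g s) (frontier D))"
    using param mem pos unfolding arc_length_parametrized_def
    by (intro continuous_intros continuous_on_infdist) auto
  then obtain I where I: "((\<lambda>s. 1 / infdist (g s) (frontier D)) has_integral I) {0..L}"
    using integrable_continuous_real unfolding integrable_on_def by blast
  have "I \<le> K"
  proof (rule has_integral_le[OF I int[folded L_def]])
    fix t assume "t \<in> {0..L}"
    then show "1 / infdist (g t) (frontier D) \<le> \<phi> t"
      unfolding g using L bound[of "t / L"] by (auto simp: L_def)
  qed
  moreover have "g 0 = x" "g L = y" using L by (auto simp: g)
  ultimately show ?thesis
    unfolding qh_joined_def using param mem I by (intro exI[of _ g] exI[of _ L] exI[of _ I]) auto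
qed

section \<open>Integrals of the model densities\<close>

lemma has_integral_const_plus_inverse:
  fixes A B e U :: real
  assumes "0 < e" "0 \<le> U"
  shows "((\<lambda>u. A + B / (e + u)) has_integral (A * U + B * ln ((e + U) / e))) {0..U}"
proof -
  have "((\<lambda>u. A + B / (e + u)) has_integral ((A * U + B * ln (e + U)) - (A * 0 + B * ln (e + 0)))) {0..U}"
    using assms
    by (intro fundamental_theorem_of_calculus)
      (auto intro!: derivative_eq_intros simp flip: has_real_derivative_iff_has_vector_derivative)
  then show ?thesis using assms by (simp add: ln_div algebra_simps)
qed

lemma has_integral_const_plus_inverse_reflected:
  fixes A B e U :: real
  assumes "0 < e" "0 \<le> U"
  shows "((\<lambda>u. A + B / (e + (U - u))) has_integral (A * U + B * ln ((e + U) / e))) {0..U}"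
proof -
  have "((\<lambda>u. A + B / (e + (U - u))) has_integral
      ((A * U - B * ln (e + (U - U))) - (A * 0 - B * ln (e + (U - 0))))) {0..U}"
    using assms
    by (intro fundamental_theorem_of_calculus)
      (auto intro!: derivative_eq_intros simp flip: has_real_derivative_iff_has_vector_derivative)
  then show ?thesis using assms by (simp add: ln_div algebra_simps)
qed

section \<open>Dyadic cubes and the walls of an apartment\<close>

lemma component_le_dist:
  fixes x y :: "real ^ 'n"
  shows "\<bar>x $ i - y $ i\<bar> \<le> dist x y"
  using component_le_norm_cart[of "x - y" i] by (simp add: dist_norm)

lemma dist_le_sqrt_card:
  fixes x y :: "real ^ 'n"
  assumes "\<And>i. \<bar>x $ i - y $ i\<bar> \<le> e"
  shows "dist x y \<le> sqrt (CARD('n)) * e"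
proof -
  have e: "0 \<le> e" using assms[of undefined] by simp
  have "dist x y = sqrt (\<Sum>i\<in>UNIV. (dist (x $ i) (y $ i))\<^sup>2)"
    by (simp add: dist_vec_def L2_set_def)
  also have "\<dots> \<le> sqrt (\<Sum>i\<in>(UNIV::'n set). e\<^sup>2)"
    using assms by (intro real_sqrt_le_mono sum_mono power_mono) (auto simp: dist_real_def)
  also have "\<dots> = sqrt (CARD('n)) * e"
    using e by (simp add: real_sqrt_mult)
  finally show ?thesis .
qed

text \<open>The segment from x to y crosses the frontier, and the crossing point is no farther from
  x than y is.\<close>

lemma infdist_frontier_le_dist:
  fixes x y :: "'a::euclidean_space"
  assumes "x \<in> S" "y \<notin> S"
  shows "infdist x (frontier S) \<le> dist x y"
proof -
  have "closed_segment x y \<inter> frontier S \<noteq> {}"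
    using assms by (intro connected_Int_frontier) auto
  then obtain q where q: "q \<in> closed_segment x y" "q \<in> frontier S" by auto
  then show ?thesis
    using infdist_le2[of q "frontier S" x] dist_in_closed_segment[of q x y] by (simp add: dist_commute)
qed

section \<open>Coordinate descriptions of cubes\<close>

lemma mem_cube: "z \<in> cube x l \<longleftrightarrow> (\<forall>i. \<bar>z $ i - x $ i\<bar> \<le> l / 2)"
proof -
  have "x $ i - l / 2 \<le> z $ i \<and> z $ i \<le> x $ i + l / 2 \<longleftrightarrow> \<bar>z $ i - x $ i\<bar> \<le> l / 2" for i
    by linarith
  then show ?thesis unfolding cube_def by simp
qed

lemma cube_eq_cbox: "cube x l = cbox (\<chi> i. x $ i - l / 2) (\<chi> i. x $ i + l / 2)"
  by (auto simp: cube_def mem_box_cart)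

lemma convex_cube: "convex (cube x l)"
  by (simp add: cube_eq_cbox convex_box)

lemma interior_cube: "interior (cube x l) = {z. \<forall>i. \<bar>z $ i - x $ i\<bar> < l / 2}"
proof -
  have "x $ i - l / 2 < z $ i \<and> z $ i < x $ i + l / 2 \<longleftrightarrow> \<bar>z $ i - x $ i\<bar> < l / 2" for i z
    by linarith
  then show ?thesis unfolding cube_eq_cbox interior_cbox by (auto simp: mem_box_cart simp del: less_divide_eq_numeral1)
qed

lemma closure_interior_cube: "0 < l \<Longrightarrow> closure (interior (cube x l)) = cube x l"
proof -
  assume "0 < l"
  then have "x \<in> interior (cube x l)" by (simp add: interior_cube)
  then have "closure (interior (cube x l)) = closure (cube x l)"
    by (intro convex_closure_interior convex_cube) blast
  then show ?thesis by (simp add: cube_eq_cbox closed_cbox)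
qed

lemma frontier_cube: "frontier (cube x l) = {b \<in> cube x l. \<exists>i. \<bar>b $ i - x $ i\<bar> = l / 2}"
proof -
  have "closed (cube x l)" by (simp add: cube_eq_cbox closed_cbox)
  then have "frontier (cube x l) = cube x l - interior (cube x l)"
    by (simp add: frontier_def)
  moreover have "b \<in> cube x l - interior (cube x l) \<longleftrightarrow> b \<in> cube x l \<and> (\<exists>i. \<bar>b $ i - x $ i\<bar> = l / 2)" for b
    unfolding Diff_iff interior_cube mem_cube mem_Collect_eq
    by (metis order.strict_iff_order)
  ultimately show ?thesis by blast
qed

lemma diameter_cube:
  fixes x :: "real ^ 'n"
  assumes "0 \<le> l"
  shows "diameter (cube x l) = sqrt (CARD('n)) * l"
proof -
  have "diameter (cube x l) = dist (\<chi> i. x $ i - l / 2) (\<chi> i. x $ i + l / 2)"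
    unfolding cube_eq_cbox using assms
    by (intro diameter_cbox) (auto simp: Basis_vec_def inner_axis)
  also have "\<dots> = sqrt (CARD('n)) * l"
    using assms by (simp add: dist_vec_def L2_set_def dist_real_def real_sqrt_mult)
  finally show ?thesis .
qed

lemma cube_inject:
  assumes "cube x l = cube x' l'" "0 < l" "0 < l'"
  shows "x = x'" "l = l'"
proof -
  have "cbox (\<chi> i. x $ i - l / 2) (\<chi> i. x $ i + l / 2) \<noteq> {}"
    using assms(2) mem_cube[of x x l] unfolding cube_eq_cbox by force
  then have "(\<chi> i. x $ i - l / 2) = (\<chi> i. x' $ i - l' / 2)" "(\<chi> i. x $ i + l / 2) = (\<chi> i. x' $ i + l' / 2)"
    using assms(1) unfolding cube_eq_cbox eq_cbox by auto
  then have *: "x $ i - l / 2 = x' $ i - l' / 2" "x $ i + l / 2 = x' $ i + l' / 2" for i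
    by (simp_all add: vec_eq_iff)
  from *[of undefined] show "l = l'" by argo
  with * show "x = x'" by (simp add: vec_eq_iff)
qed

lemma dyadic_cube_eq_cube:
  "{z. \<forall>i. of_int (m i) * 2 powi k \<le> z $ i \<and> z $ i \<le> (of_int (m i) + 1) * 2 powi k}
    = cube (\<chi> i. (of_int (m i) + 1 / 2) * 2 powi k) (2 powi k)"
  by (auto simp: cube_def algebra_simps)

text \<open>Both intervals have their endpoints on the grid of mesh 2^k of the smaller one. Disjoint
  ones are therefore at least one mesh apart.\<close>

lemma dyadic_intervals_meet:
  fixes p q :: real and m m' k k' :: int
  assumes "k \<le> k'"
    and p: "of_int m * 2 powi k \<le> p" "p \<le> (of_int m + 1) * 2 powi k"
    and q: "of_int m' * 2 powi k' \<le> q" "q \<le> (of_int m' + 1) * 2 powi k'"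
    and "\<bar>p - q\<bar> < 2 powi k"
  shows "\<exists>v. of_int m * 2 powi k \<le> v \<and> v \<le> (of_int m + 1) * 2 powi k \<and>
    of_int m' * 2 powi k' \<le> v \<and> v \<le> (of_int m' + 1) * (2::real) powi k'"
proof -
  define s :: real where "s = 2 powi k"
  \<comment> \<open>N is the ratio of the side lengths; M = m' N is then the left endpoint of the
    larger interval counted in steps of the finer grid.\<close>
  define N :: int where "N = 2 ^ nat (k' - k)"
  have s: "s > 0" by (simp add: s_def)
  have N: "N \<ge> 1" by (simp add: N_def)
  have "(2::real) powi k' = 2 powi (k' - k) * 2 powi k"
    by (simp flip: power_int_add)
  also have "(2::real) powi (k' - k) = of_int N"
    using assms(1) by (simp add: power_int_def N_def)
  finally have k': "(2::real) powi k' = of_int N * s" by (simp add: s_def)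
  define M where "M = m' * N"
  have q': "of_int M * s \<le> q" "q \<le> of_int (M + N) * s"
    using q unfolding k' M_def by (auto simp: algebra_simps)
  have p': "of_int m * s \<le> p" "p \<le> of_int (m + 1) * s"
    using p unfolding s_def by auto
  have pq: "\<bar>p - q\<bar> < s" using assms by (simp add: s_def)
  have "of_int M * s < of_int (m + 2) * s" "of_int m * s < of_int (M + N + 1) * s"
    using p' q' pq by (auto simp: algebra_simps)
  then have "M \<le> m + 1" "m \<le> M + N"
    using s by (auto simp: mult_less_cancel_right)
  \<comment> \<open>The larger of the two left endpoints lies in both intervals.\<close>
  then have "of_int (max m M) * s \<ge> of_int m * s" "of_int (max m M) * s \<ge> of_int M * s"
    "of_int (max m M) * s \<le> of_int (m + 1) * s" "of_int (max m M) * s \<le> of_int (M + N) * s"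
    using s N by (auto intro!: mult_right_mono)
  then show ?thesis
    unfolding k' by (intro exI[of _ "of_int (max m M) * s"]) (auto simp: s_def M_def algebra_simps)
qed

text \<open>Cubes are products of intervals, so common points chosen in each coordinate assemble to
  a common point of the cubes.\<close>

lemma dyadic_cubes_meet:
  fixes p q :: "real ^ 'n"
  assumes "dyadic_cube (cube x l)" "dyadic_cube (cube x' l')" "0 < l" "0 < l'"
    and "p \<in> cube x l" "q \<in> cube x' l'" "dist p q < l" "dist p q < l'"
  shows "cube x l \<inter> cube x' l' \<noteq> {}"
proof -
  obtain k m where km: "cube x l =
      {z. \<forall>i. of_int (m i) * 2 powi k \<le> z $ i \<and> z $ i \<le> (of_int (m i) + 1) * 2 powi k}"
    using assms(1) unfolding dyadic_cube_def by blast
  then have l: "l = 2 powi k"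
    using cube_inject(2)[of x l] assms(3) unfolding dyadic_cube_eq_cube by simp
  obtain k' m' where km': "cube x' l' =
      {z. \<forall>i. of_int (m' i) * 2 powi k' \<le> z $ i \<and> z $ i \<le> (of_int (m' i) + 1) * 2 powi k'}"
    using assms(2) unfolding dyadic_cube_def by blast
  then have l': "l' = 2 powi k'"
    using cube_inject(2)[of x' l'] assms(4) unfolding dyadic_cube_eq_cube by simp
  have "\<exists>v. of_int (m i) * 2 powi k \<le> v \<and> v \<le> (of_int (m i) + 1) * 2 powi k \<and>
      of_int (m' i) * 2 powi k' \<le> v \<and> v \<le> (of_int (m' i) + 1) * (2::real) powi k'" for i
  proof -
    have pq: "\<bar>p $ i - q $ i\<bar> < 2 powi k" "\<bar>q $ i - p $ i\<bar> < 2 powi k'"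
      using component_le_dist[of p i q] assms(7,8) l l' by auto
    show ?thesis
    proof (cases "k \<le> k'")
      case True
      then show ?thesis
        using dyadic_intervals_meet[OF True, of "m i" "p $ i" "m' i" "q $ i"] assms(5,6) pq
        unfolding km km' by auto
    next
      case False
      then have "k' \<le> k" by simp
      then show ?thesis
        using dyadic_intervals_meet[OF \<open>k' \<le> k\<close>, of "m' i" "q $ i" "m i" "p $ i"] assms(5,6) pq
        unfolding km km' by auto
    qed
  qed
  then obtain v where v: "\<And>i. of_int (m i) * 2 powi k \<le> v i \<and> v i \<le> (of_int (m i) + 1) * 2 powi k \<and>
      of_int (m' i) * 2 powi k' \<le> v i \<and> v i \<le> (of_int (m' i) + 1) * (2::real) powi k'"
    by metis
  then have "(\<chi> i. v i) \<in> cube x l \<inter> cube x' l'"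
    unfolding km km' by auto
  then show ?thesis by blast
qed

text \<open>An open set that misses the interior of the cube also misses the closure of that
  interior, which is the whole cube.\<close>

lemma disjoint_interiors_imp_notin_interior:
  assumes "0 < l" "interior (cube x l) \<inter> interior Q = {}" "z \<in> cube x l"
  shows "z \<notin> interior Q"
  using assms open_Int_closure_eq_empty[OF open_interior, of Q "interior (cube x l)"]
  by (auto simp: closure_interior_cube)

text \<open>The part of the two boundaries that the long passage does not reopen. An apartment is
  its cube minus this set, as \<open>apartment_eq\<close> shows.\<close>

definition wall :: "real \<Rightarrow> real ^ 'n::{finite,linorder} \<Rightarrow> real \<Rightarrow> (real ^ 'n::{finite,linorder}) set" where
  "wall \<beta> x l = (frontier (room x l) \<union> frontier (passage \<beta> x l)) - long_passage \<beta> x l"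

lemma frontier_box_subset: "frontier (box a b) \<subseteq> cbox a b - box a (b::'a::euclidean_space)"
  by (simp add: frontier_box)

lemma frontier_roomD:
  assumes "w \<in> frontier (room x l)"
  shows "\<bar>w $ i - x $ i\<bar> \<le> l / 8" "\<exists>i. l / 8 \<le> \<bar>w $ i - x $ i\<bar>"
proof -
  have "room x l = box (\<chi> i. x $ i - l / 8) (\<chi> i. x $ i + l / 8)"
    by (auto simp: room_def mem_box_cart)
  then have "w \<in> cbox (\<chi> i. x $ i - l / 8) (\<chi> i. x $ i + l / 8) - box (\<chi> i. x $ i - l / 8) (\<chi> i. x $ i + l / 8)"
    using assms frontier_box_subset by fastforce
  then have *: "\<And>i. x $ i - l / 8 \<le> w $ i \<and> w $ i \<le> x $ i + l / 8"
    "\<exists>i. \<not> (x $ i - l / 8 < w $ i \<and> w $ i < x $ i + l / 8)"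
    by (auto simp: mem_box_cart)
  show "\<bar>w $ i - x $ i\<bar> \<le> l / 8" using *(1)[of i] by linarith
  obtain i where "\<not> (x $ i - l / 8 < w $ i \<and> w $ i < x $ i + l / 8)" using *(2) by blast
  then have "l / 8 \<le> \<bar>w $ i - x $ i\<bar>" by linarith
  then show "\<exists>i. l / 8 \<le> \<bar>w $ i - x $ i\<bar>" by blast
qed

lemma frontier_passageD:
  fixes x :: "real ^ 'n::{finite,linorder}"
  assumes "w \<in> frontier (passage \<beta> x l)"
  shows "i \<noteq> last_index \<Longrightarrow> \<bar>w $ i - x $ i\<bar> \<le> (l / 8) powr (1 / \<beta>)"
    "l / 8 \<le> w $ last_index - x $ last_index"
    "w $ last_index - x $ last_index \<le> l / 8 + (l / 8) powr (1 / \<beta>)"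
proof -
  define r where "r = (l / 8) powr (1 / \<beta>)"
  define a :: "real ^ 'n::{finite,linorder}" where "a = (\<chi> i. if i = last_index then x $ i + l / 8 else x $ i - r)"
  define b :: "real ^ 'n::{finite,linorder}" where "b = (\<chi> i. if i = last_index then x $ i + l / 8 + r else x $ i + r)"
  have "z \<in> passage \<beta> x l \<longleftrightarrow> (\<forall>i. a $ i < z $ i \<and> z $ i < b $ i)" for z
    unfolding passage_def a_def b_def r_def[symmetric] by (auto split: if_splits)
  then have "passage \<beta> x l = box a b"
    by (auto simp: mem_box_cart)
  then have "w \<in> cbox a b"
    using assms frontier_box_subset by fastforce
  then have *: "a $ i \<le> w $ i" "w $ i \<le> b $ i" for i
    by (auto simp: mem_box_cart)
  show "\<bar>w $ i - x $ i\<bar> \<le> r" if "i \<noteq> last_index"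
    using *[of i] that by (auto simp: a_def b_def)
  show "l / 8 \<le> w $ last_index - x $ last_index" "w $ last_index - x $ last_index \<le> l / 8 + r"
    using *[of last_index] by (auto simp: a_def b_def)
qed

text \<open>The coordinate facts behind all distance estimates. Clauses 1 to 3 enclose the wall in a
  box, clause 4 keeps it out of the open room, clause 5 keeps it at lateral distance r from the axis
  except on the floor, and clause 6 says that only the passage rises above the ceiling.\<close>

lemma wallD:
  assumes w: "w \<in> wall \<beta> x l" and l: "0 < l" and r: "r = (l / 8) powr (1 / \<beta>)" "r \<le> l / 8"
  shows "i \<noteq> last_index \<Longrightarrow> \<bar>w $ i - x $ i\<bar> \<le> l / 8"
    "- (l / 8) \<le> w $ last_index - x $ last_index"
    "w $ last_index - x $ last_index \<le> l / 8 + r"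
    "\<exists>i. l / 8 \<le> \<bar>w $ i - x $ i\<bar>"
    "(\<exists>i. i \<noteq> last_index \<and> r \<le> \<bar>w $ i - x $ i\<bar>) \<or> w $ last_index = x $ last_index - l / 8"
    "w $ last_index \<le> x $ last_index + l / 8 \<or> (\<forall>i. i \<noteq> last_index \<longrightarrow> \<bar>w $ i - x $ i\<bar> \<le> r)"
proof -
  have r0: "0 \<le> r" using r by simp
  have L: "\<not> ((\<forall>i. i \<noteq> last_index \<longrightarrow> \<bar>w $ i - x $ i\<bar> < r) \<and>
      x $ last_index < w $ last_index \<and> w $ last_index < x $ last_index + l / 2)"
    using w unfolding wall_def long_passage_def r(1)[symmetric] by (auto simp: abs_less_iff algebra_simps)
  consider (R) "w \<in> frontier (room x l)" | (P) "w \<in> frontier (passage \<beta> x l)"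
    using w unfolding wall_def by blast
  then have "(\<forall>i. i \<noteq> last_index \<longrightarrow> \<bar>w $ i - x $ i\<bar> \<le> l / 8) \<and>
    - (l / 8) \<le> w $ last_index - x $ last_index \<and>
    w $ last_index - x $ last_index \<le> l / 8 + r \<and>
    (\<exists>i. l / 8 \<le> \<bar>w $ i - x $ i\<bar>) \<and>
    ((\<exists>i. i \<noteq> last_index \<and> r \<le> \<bar>w $ i - x $ i\<bar>) \<or> w $ last_index = x $ last_index - l / 8) \<and>
    (w $ last_index \<le> x $ last_index + l / 8 \<or> (\<forall>i. i \<noteq> last_index \<longrightarrow> \<bar>w $ i - x $ i\<bar> \<le> r))"
  proof cases
    case R
    note F = frontier_roomD[OF R]
    obtain j where j: "l / 8 \<le> \<bar>w $ j - x $ j\<bar>" using F(2) by blast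
    have n: "\<bar>w $ last_index - x $ last_index\<bar> \<le> l / 8" by (rule F(1))
    \<comment> \<open>If all lateral coordinates are below r, a point of the room boundary is on the
      ceiling or on the floor. On the ceiling it would lie in the long passage, so the floor
      remains.\<close>
    have "(\<exists>i. i \<noteq> last_index \<and> r \<le> \<bar>w $ i - x $ i\<bar>) \<or> w $ last_index = x $ last_index - l / 8"
    proof (cases "\<exists>i. i \<noteq> last_index \<and> r \<le> \<bar>w $ i - x $ i\<bar>")
      case False
      then have "j = last_index" using j r(2) by force
      then have "l / 8 \<le> \<bar>w $ last_index - x $ last_index\<bar>" using j by simp
      moreover have "\<not> (x $ last_index < w $ last_index \<and> w $ last_index < x $ last_index + l / 2)"
        using L False by (meson not_le)
      ultimately have "w $ last_index = x $ last_index - l / 8"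
        using n l by linarith
      then show ?thesis by blast
    qed blast
    moreover have "- (l / 8) \<le> w $ last_index - x $ last_index"
      "w $ last_index - x $ last_index \<le> l / 8 + r" "w $ last_index \<le> x $ last_index + l / 8"
      using n r0 by linarith+
    ultimately show ?thesis using F by blast
  next
    case P
    note F = frontier_passageD[OF P, folded r(1)]
    have "x $ last_index < w $ last_index" "w $ last_index < x $ last_index + l / 2"
      using F(2,3) l r(2) by linarith+
    then have "\<exists>i. i \<noteq> last_index \<and> r \<le> \<bar>w $ i - x $ i\<bar>"
      using L by (meson not_le)
    moreover have "l / 8 \<le> \<bar>w $ last_index - x $ last_index\<bar>" using F(2) by linarith
    moreover have "- (l / 8) \<le> w $ last_index - x $ last_index" using F(2) l by linarith
    moreover have "\<forall>i. i \<noteq> last_index \<longrightarrow> \<bar>w $ i - x $ i\<bar> \<le> l / 8"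
      using F(1) r(2) by (meson order_trans)
    ultimately show ?thesis using F by blast
  qed
  then show "i \<noteq> last_index \<Longrightarrow> \<bar>w $ i - x $ i\<bar> \<le> l / 8"
    "- (l / 8) \<le> w $ last_index - x $ last_index"
    "w $ last_index - x $ last_index \<le> l / 8 + r"
    "\<exists>i. l / 8 \<le> \<bar>w $ i - x $ i\<bar>"
    "(\<exists>i. i \<noteq> last_index \<and> r \<le> \<bar>w $ i - x $ i\<bar>) \<or> w $ last_index = x $ last_index - l / 8"
    "w $ last_index \<le> x $ last_index + l / 8 \<or> (\<forall>i. i \<noteq> last_index \<longrightarrow> \<bar>w $ i - x $ i\<bar> \<le> r)"
    by blast+
qed

section \<open>The \<open>\<beta>\<close>-version near the boundary of a Whitney cube\<close>

locale whitney_apartments =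
  fixes G :: "(real ^ 'n::{finite,linorder}) set" and W :: "(real ^ 'n::{finite,linorder}) set set" and \<beta> N :: real
  assumes N_eq: "N = sqrt (real CARD('n))"
    and card_ge_2: "2 \<le> CARD('n)"
    and open_G: "open G" and bounded_G: "bounded G" and G_nonempty: "G \<noteq> {}" and diameter_G: "diameter G \<le> 4"
    and W: "whitney_decomposition G W"
    and \<beta>_pos: "0 < \<beta>" and \<beta>_le_1: "\<beta> \<le> 1"
begin

abbreviation D :: "(real ^ 'n::{finite,linorder}) set" where "D \<equiv> beta_version \<beta> W"
abbreviation \<delta> :: "real ^ 'n::{finite,linorder} \<Rightarrow> real" where "\<delta> z \<equiv> infdist z (frontier G)"
abbreviation \<delta>\<^sub>D :: "real ^ 'n::{finite,linorder} \<Rightarrow> real" where "\<delta>\<^sub>D z \<equiv> infdist z (frontier D)"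
abbreviation whitney :: "real ^ 'n::{finite,linorder} \<Rightarrow> real \<Rightarrow> bool" where
  "whitney x l \<equiv> 0 < l \<and> cube x l \<in> W"

section \<open>Whitney cubes and the distance to the boundary of G\<close>

lemma N_ge_1: "1 \<le> N"
  using card_ge_2 by (simp add: N_eq)

lemma diameter_cube_N: "0 \<le> l \<Longrightarrow> diameter (cube (x :: real ^ 'n::{finite,linorder}) l) = N * l"
  by (simp add: diameter_cube N_eq)

lemma mem_G_iff: "z \<in> G \<longleftrightarrow> (\<exists>x l. whitney x l \<and> z \<in> cube x l)"
proof -
  have "\<exists>x l. 0 < l \<and> Q = cube x l" if "Q \<in> W" for Q
  proof -
    have "dyadic_cube Q" using W that by (auto simp: whitney_decomposition_def)
    then obtain k m where "Q = {z. \<forall>i. of_int (m i) * 2 powi k \<le> z $ i \<and> z $ i \<le> (of_int (m i) + 1) * 2 powi k}"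
      unfolding dyadic_cube_def by blast
    then show ?thesis unfolding dyadic_cube_eq_cube
      by (metis zero_less_numeral zero_less_power_int)
  qed
  moreover have "\<Union>W = G" using W by (simp add: whitney_decomposition_def)
  ultimately show ?thesis by (metis UnionE UnionI)
qed

lemma frontier_G_nonempty: "frontier G \<noteq> {}"
  using G_nonempty bounded_G by (metis frontier_not_empty not_bounded_UNIV)

lemma cube_subset_G: "whitney x l \<Longrightarrow> cube x l \<subseteq> G"
  using mem_G_iff by blast

lemma dist_cube_le:
  fixes x :: "real ^ 'n::{finite,linorder}"
  assumes "0 < l" "z \<in> cube x l" "z' \<in> cube x l"
  shows "dist z z' \<le> N * l"
  using diameter_bounded_bound[of "cube x l" z z'] assms diameter_cube_N[of l x]
  by (simp add: cube_eq_cbox bounded_cbox)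

lemma side_le_4:
  assumes "whitney x l"
  shows "l \<le> 4"
proof -
  have "l \<le> N * l" using assms N_ge_1 by simp
  also have "\<dots> \<le> diameter G"
    using diameter_subset[OF cube_subset_G[OF assms] bounded_G] diameter_cube_N[of l x] assms by simp
  finally show ?thesis using diameter_G by simp
qed

lemma passage_width:
  assumes "whitney x l"
  shows "0 < (l / 8) powr (1 / \<beta>)" "(l / 8) powr (1 / \<beta>) \<le> l / 8"
proof -
  show "0 < (l / 8) powr (1 / \<beta>)" using assms by simp
  have "(l / 8) powr (1 / \<beta>) \<le> (l / 8) powr 1"
    using assms side_le_4[OF assms] \<beta>_pos \<beta>_le_1 by (intro powr_mono') auto
  then show "(l / 8) powr (1 / \<beta>) \<le> l / 8" using assms by simp
qed

lemmas wallD' = wallD[OF _ conjunct1 refl passage_width(2)]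

lemma \<delta>_ge:
  assumes "whitney x l" "z \<in> cube x l"
  shows "N * l \<le> \<delta> z"
proof -
  have "N * l \<le> setdist (cube x l) (frontier G)"
    using W assms diameter_cube_N[of l x] by (auto simp: whitney_decomposition_def)
  also have "\<dots> \<le> setdist {z} (frontier G)"
    using assms by (intro setdist_subset_left) auto
  finally show ?thesis by (simp add: infdist_eq_setdist)
qed

lemma \<delta>_ge_side:
  assumes "whitney x l" "z \<in> cube x l"
  shows "l \<le> \<delta> z"
proof -
  have "1 * l \<le> N * l" using assms(1) N_ge_1 by (intro mult_right_mono) auto
  then show ?thesis using \<delta>_ge[OF assms] by linarith
qed

text \<open>The factor 5 is 4 + 1: at most four diameters from the cube to the boundary and one
  diameter inside the cube.\<close>

lemma \<delta>_le:
  assumes "whitney x l" "z \<in> cube x l"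
  shows "\<delta> z \<le> 5 * N * l"
proof -
  have "\<delta> z - N * l \<le> setdist (cube x l) (frontier G)"
  proof (rule le_setdistI)
    fix p q assume "p \<in> cube x l" "q \<in> frontier G"
    then show "\<delta> z - N * l \<le> dist p q"
      using infdist_le[of q "frontier G" z] dist_cube_le[of l z x p] assms dist_triangle[of z q p] by auto
  qed (use assms frontier_G_nonempty in auto)
  also have "\<dots> \<le> 4 * (N * l)"
    using W assms diameter_cube_N[of l x] by (auto simp: whitney_decomposition_def)
  finally show ?thesis by simp
qed

lemma notin_interior_other:
  assumes "whitney x l" "whitney x' l'" "cube x l \<noteq> cube x' l'" "z \<in> cube x l"
  shows "z \<notin> interior (cube x' l')"
  using disjoint_interiors_imp_notin_interior[of l x "cube x' l'" z] W assms
  by (auto simp: whitney_decomposition_def pairwise_def)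

text \<open>The wall ends at height l / 8 + r with r \<le> l / 8, so it stays in the concentric cube
  of half the side.\<close>

lemma wall_half_cube:
  assumes "whitney x l" "w \<in> wall \<beta> x l"
  shows "\<bar>w $ i - x $ i\<bar> \<le> l / 4"
proof (cases "i = last_index")
  case True
  then show ?thesis
    using wallD'(2,3)[OF assms(2,1,1)] passage_width(2)[OF assms(1)] assms(1) unfolding True by linarith
next
  case False
  then show ?thesis
    using wallD'(1)[OF assms(2,1,1) False] assms(1) by linarith
qed

lemma dist_wall_ge:
  assumes "whitney x l" "w \<in> wall \<beta> x l" "z \<notin> interior (cube x l)"
  shows "l / 4 \<le> dist z w"
proof -
  obtain i where "l / 2 \<le> \<bar>z $ i - x $ i\<bar>"
    using assms(3) unfolding interior_cube mem_Collect_eq by (meson not_le)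
  then show ?thesis
    using wall_half_cube[OF assms(1,2), of i] component_le_dist[of z i w] by linarith
qed

text \<open>Here l \<le> 4 dist z w, hence \<delta> w \<le> 5 N l \<le> 20 N dist z w, and \<delta>
  is 1-Lipschitz.\<close>

lemma dist_wall_far:
  assumes "whitney x l" "w \<in> wall \<beta> x l" "z \<notin> interior (cube x l)"
  shows "\<delta> z \<le> (1 + 20 * N) * dist z w"
proof -
  have "w \<in> cube x l"
    unfolding mem_cube
  proof
    fix i show "\<bar>w $ i - x $ i\<bar> \<le> l / 2"
      using wall_half_cube[OF assms(1,2), of i] assms(1) by linarith
  qed
  then have "\<delta> w \<le> 5 * N * l" using \<delta>_le assms(1) by blast
  also have "\<dots> \<le> 5 * N * (4 * dist z w)"
    using dist_wall_ge[OF assms] N_ge_1 by (intro mult_left_mono) auto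
  finally show ?thesis
    using infdist_triangle[of z "frontier G" w] by (simp add: algebra_simps)
qed

lemma long_passage_subset_cube:
  assumes "whitney x l"
  shows "long_passage \<beta> x l \<subseteq> cube x l"
proof
  fix z assume z: "z \<in> long_passage \<beta> x l"
  show "z \<in> cube x l"
    unfolding mem_cube
  proof
    fix i
    consider "i = last_index" "x $ i < z $ i" "z $ i < x $ i + l / 2"
      | "x $ i - (l / 8) powr (1 / \<beta>) < z $ i" "z $ i < x $ i + (l / 8) powr (1 / \<beta>)"
      using z unfolding long_passage_def by auto
    then show "\<bar>z $ i - x $ i\<bar> \<le> l / 2"
      using passage_width(2)[OF assms] assms by cases linarith+
  qed
qed

lemma apartment_eq:
  assumes "whitney x l"
  shows "apartment \<beta> x l = cube x l - wall \<beta> x l"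
  using long_passage_subset_cube[OF assms] unfolding apartment_def wall_def by blast

lemma D_eq: "D = \<Union>{cube x l - wall \<beta> x l | x l. whitney x l}"
  unfolding beta_version_def using apartment_eq by blast

lemma D_subset_G: "D \<subseteq> G"
  unfolding D_eq using cube_subset_G by blast

lemma mem_D_cube: "z \<in> D \<Longrightarrow> \<exists>x l. whitney x l \<and> z \<in> cube x l"
  unfolding D_eq by blast

lemma mem_DI: "\<lbrakk>whitney x l; z \<in> cube x l; z \<notin> wall \<beta> x l\<rbrakk> \<Longrightarrow> z \<in> D"
  unfolding D_eq by blast

text \<open>Source of the constant 21: a wall of another cube is at distance at least \<delta> z /
  (1 + 20 N) \<ge> N l / (21 N) = l / 21. Up to that scale only the wall of the cube containing z
  has to be controlled.\<close>

lemma ball_subset_D: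
  assumes "whitney x l" "z \<in> cube x l" "\<rho> \<le> l / 21" "\<And>w. w \<in> wall \<beta> x l \<Longrightarrow> \<rho> \<le> dist z w"
  shows "ball z \<rho> \<subseteq> D"
proof
  fix y assume "y \<in> ball z \<rho>"
  then have y: "dist z y < \<rho>" by simp
  have "y \<in> G"
  proof (rule ccontr)
    assume "y \<notin> G"
    then have "\<delta> z \<le> dist z y"
      using assms cube_subset_G by (intro infdist_frontier_le_dist) auto
    then show False using y assms(3) \<delta>_ge_side[OF assms(1,2)] assms(1) by linarith
  qed
  then obtain x' l' where x': "whitney x' l'" "y \<in> cube x' l'" using mem_G_iff by blast
  have "y \<notin> wall \<beta> x' l'"
  proof
    assume y': "y \<in> wall \<beta> x' l'"
    show False
    proof (cases "cube x l = cube x' l'")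
      case True
      then show False using cube_inject[OF True] assms(1,4) x' y' y by fastforce
    next
      case False
      have "N * l \<le> \<delta> z" using \<delta>_ge assms by blast
      also have "\<dots> \<le> (1 + 20 * N) * dist z y"
        using notin_interior_other[OF assms(1) x'(1) False assms(2)] by (intro dist_wall_far[OF x'(1) y'])
      also have "\<dots> < (1 + 20 * N) * (l / 21)"
        using y assms(3) N_ge_1 by (intro mult_strict_left_mono) auto
      also have "\<dots> \<le> (21 * N) * (l / 21)"
        using N_ge_1 assms(1) by (intro mult_right_mono) auto
      finally show False by simp
    qed
  qed
  then show "y \<in> D" using mem_DI x' by blast
qed

lemma open_D: "open D"
  unfolding open_contains_ball
proof
  fix z assume "z \<in> D"
  then obtain x l where x: "whitney x l" "z \<in> cube x l" "z \<notin> wall \<beta> x l" unfolding D_eq by blast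
  \<comment> \<open>The long passage is an open box, so removing it from the two frontiers leaves a
    closed set.\<close>
  have "closed (wall \<beta> x l)"
  proof -
    define a :: "real ^ 'n::{finite,linorder}"
      where "a = (\<chi> i. if i = last_index then x $ i else x $ i - (l / 8) powr (1 / \<beta>))"
    define b :: "real ^ 'n::{finite,linorder}"
      where "b = (\<chi> i. if i = last_index then x $ i + l / 2 else x $ i + (l / 8) powr (1 / \<beta>))"
    have "y \<in> long_passage \<beta> x l \<longleftrightarrow> (\<forall>i. a $ i < y $ i \<and> y $ i < b $ i)" for y
      unfolding long_passage_def a_def b_def by (auto split: if_splits)
    then have "long_passage \<beta> x l = box a b"
      by (auto simp: mem_box_cart)
    then show ?thesis unfolding wall_def by (auto intro!: closed_Diff closed_Un simp: open_box)
  qed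
  then obtain e where e: "e > 0" "ball z e \<subseteq> - wall \<beta> x l"
    using x(3) open_contains_ball[of "- wall \<beta> x l"] by auto
  then have "ball z (min e (l / 21)) \<subseteq> D"
    using x(1,2) by (intro ball_subset_D) (force simp: not_less min.coboundedI1 subset_iff)+
  moreover have "min e (l / 21) > 0" using e x by simp
  ultimately show "\<exists>e>0. ball z e \<subseteq> D" by blast
qed

lemma bounded_D: "bounded D"
  using D_subset_G bounded_G bounded_subset by blast

lemma frontier_cube_subset_D: "whitney x l \<Longrightarrow> frontier (cube x l) \<subseteq> D"
proof
  fix b assume x: "whitney x l" and b: "b \<in> frontier (cube x l)"
  then have "b \<in> cube x l" "b \<notin> interior (cube x l)"
    by (auto simp: frontier_cube interior_cube)
  then show "b \<in> D"
    using dist_wall_ge[OF x, of b b] x by (intro mem_DI[OF x]) auto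
qed

lemma D_nonempty: "D \<noteq> {}"
proof -
  obtain x l where x: "whitney x l" using mem_G_iff G_nonempty by blast
  then have "(\<chi> i. x $ i + l / 2) \<in> frontier (cube x l)" by (simp add: frontier_cube mem_cube)
  then show ?thesis using frontier_cube_subset_D[OF x] by blast
qed

lemma frontier_D_nonempty: "frontier D \<noteq> {}"
  using D_nonempty bounded_D by (metis frontier_not_empty not_bounded_UNIV)

lemma \<delta>\<^sub>D_pos: "z \<in> D \<Longrightarrow> 0 < \<delta>\<^sub>D z"
  using open_D frontier_D_nonempty
  by (metis disjoint_iff frontier_closed frontier_disjoint_eq infdist_pos_not_in_closed)

lemma \<delta>\<^sub>D_ge:
  assumes "whitney x l" "z \<in> cube x l" "\<rho> \<le> l / 21" "\<And>w. w \<in> wall \<beta> x l \<Longrightarrow> \<rho> \<le> dist z w"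
  shows "\<rho> \<le> \<delta>\<^sub>D z"
proof -
  have "\<rho> \<le> dist z q" if "q \<in> frontier D" for q
  proof -
    have "q \<notin> D" using that open_D frontier_disjoint_eq by blast
    then have "q \<notin> ball z \<rho>" using ball_subset_D[OF assms] by blast
    then show ?thesis by simp
  qed
  then show ?thesis
    using frontier_D_nonempty by (auto simp: infdist_notempty intro: cINF_greatest)
qed

lemma \<delta>\<^sub>D_le_\<delta>:
  assumes "z \<in> D"
  shows "\<delta>\<^sub>D z \<le> \<delta> z"
proof -
  have "\<delta>\<^sub>D z \<le> dist z q" if "q \<in> frontier G" for q
    using that open_G frontier_disjoint_eq[of G] D_subset_G assms
    by (intro infdist_frontier_le_dist) auto
  then show ?thesis
    using frontier_G_nonempty by (auto simp: infdist_notempty[of "frontier G"] intro: cINF_greatest)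
qed

section \<open>Moving inside one cube and between touching cubes\<close>

lemma segment_in_cube:
  assumes "z \<in> cube x l" "z' \<in> cube x l" "\<tau> \<in> {0..1}"
  shows "z + \<tau> *\<^sub>R (z' - z) \<in> cube x l"
proof -
  have "z + \<tau> *\<^sub>R (z' - z) = (1 - \<tau>) *\<^sub>R z + \<tau> *\<^sub>R z'" by (simp add: algebra_simps)
  then show ?thesis using convexD[OF convex_cube assms(1,2), of "1 - \<tau>" \<tau>] assms(3) by simp
qed

text \<open>The density splits by 1 / min a b \<le> 1 / a + 1 / b. The first part is 21 / l on a
  segment of length at most N l, which costs 21 N; the second part costs K.\<close>

lemma qh_joined_in_cube:
  assumes x: "whitney x l" and z: "z \<in> cube x l" "z' \<in> cube x l"
    and D: "\<And>\<tau>. \<tau> \<in> {0..1} \<Longrightarrow> z + \<tau> *\<^sub>R (z' - z) \<in> D"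
    and pos: "\<And>u. u \<in> {0..dist z z'} \<Longrightarrow> 0 < f u"
    and bound: "\<And>\<tau>. \<tau> \<in> {0..1} \<Longrightarrow> min (l / 21) (f (\<tau> * dist z z')) \<le> \<delta>\<^sub>D (z + \<tau> *\<^sub>R (z' - z))"
    and int: "((\<lambda>u. 1 / f u) has_integral K) {0..dist z z'}"
  shows "qh_joined D (21 * N + K) z z'"
proof -
  have "((\<lambda>u. 21 / l) has_integral 21 / l * dist z z') {0..dist z z'}"
    using has_integral_const_real[of "21 / l" 0 "dist z z'"] by (simp add: mult.commute)
  then have "((\<lambda>u. 21 / l + 1 / f u) has_integral (21 / l * dist z z' + K)) {0..dist z z'}"
    using int by (intro has_integral_add)
  then have "qh_joined D (21 / l * dist z z' + K) z z'"
  proof (rule qh_joined_segment[OF open_D frontier_D_nonempty, rotated 2])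
    fix \<tau> :: real assume \<tau>: "\<tau> \<in> {0..1}"
    define f' where "f' = f (\<tau> * dist z z')"
    define d where "d = \<delta>\<^sub>D (z + \<tau> *\<^sub>R (z' - z))"
    have f': "0 < f'" unfolding f'_def using \<tau> by (intro pos) (auto simp: mult_left_le_one_le)
    have d: "min (l / 21) f' \<le> d" unfolding f'_def d_def using \<tau> by (rule bound)
    have "1 / d \<le> 1 / min (l / 21) f'"
      using d f' x by (intro divide_left_mono mult_pos_pos) auto
    also have "\<dots> \<le> 21 / l + 1 / f'"
      using f' x by (auto simp: min_def)
    finally show "1 / \<delta>\<^sub>D (z + \<tau> *\<^sub>R (z' - z)) \<le> 21 / l + 1 / f (\<tau> * dist z z')"
      by (simp only: d_def f'_def)
  qed (rule D)
  moreover have "21 / l * dist z z' \<le> 21 / l * (N * l)"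
    using x dist_cube_le[of l z x z'] z by (intro mult_left_mono) auto
  then have "21 / l * dist z z' \<le> 21 * N" using x by simp
  ultimately show ?thesis by (auto elim: qh_joined_mono)
qed

lemma qh_joined_off_walls:
  assumes x: "whitney x l" and z: "z \<in> cube x l" "z' \<in> cube x l"
    and pos: "\<And>u. u \<in> {0..dist z z'} \<Longrightarrow> 0 < f u"
    and bound: "\<And>\<tau> w. \<tau> \<in> {0..1} \<Longrightarrow> w \<in> wall \<beta> x l \<Longrightarrow> f (\<tau> * dist z z') \<le> dist (z + \<tau> *\<^sub>R (z' - z)) w"
    and int: "((\<lambda>u. 1 / f u) has_integral K) {0..dist z z'}"
  shows "qh_joined D (21 * N + K) z z'"
proof (rule qh_joined_in_cube[OF x z])
  fix \<tau> :: real assume \<tau>: "\<tau> \<in> {0..1}"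
  let ?y = "z + \<tau> *\<^sub>R (z' - z)"
  have p: "0 < f (\<tau> * dist z z')" using \<tau> by (intro pos) (auto simp: mult_left_le_one_le)
  have y: "?y \<in> cube x l" using segment_in_cube[OF z \<tau>] .
  show "?y \<in> D" using bound[OF \<tau>, of ?y] p by (intro mem_DI[OF x y]) auto
  show "min (l / 21) (f (\<tau> * dist z z')) \<le> \<delta>\<^sub>D ?y"
    using bound[OF \<tau>] by (intro \<delta>\<^sub>D_ge[OF x y]) (auto simp: min.coboundedI2)
qed (use pos int in auto)

text \<open>On a face the wall is at distance at least l / 4, so it adds at most (4 / l) N l = 4 N
  to the 21 N.\<close>

lemma qh_joined_in_face:
  assumes x: "whitney x l" and z: "z \<in> cube x l" "z' \<in> cube x l"
    and i: "\<bar>z $ i - x $ i\<bar> = l / 2" "z' $ i = z $ i"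
  shows "qh_joined D (25 * N) z z'"
proof -
  have "((\<lambda>u. 1 / (l / 4)) has_integral 4 / l * dist z z') {0..dist z z'}"
    using has_integral_const_real[of "4 / l" 0 "dist z z'"] by (simp add: mult.commute)
  then have "qh_joined D (21 * N + 4 / l * dist z z') z z'"
  proof (rule qh_joined_off_walls[OF x z, rotated 2])
    fix \<tau> :: real and w assume \<tau>: "\<tau> \<in> {0..1}" and w: "w \<in> wall \<beta> x l"
    have "(z + \<tau> *\<^sub>R (z' - z)) \<notin> interior (cube x l)"
      using i by (auto simp: interior_cube intro!: exI[of _ i])
    then show "l / 4 \<le> dist (z + \<tau> *\<^sub>R (z' - z)) w" by (rule dist_wall_ge[OF x w])
  qed (use x in simp)
  moreover have "4 / l * dist z z' \<le> 4 / l * (N * l)"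
    using x dist_cube_le[of l z x z'] z by (intro mult_left_mono) auto
  then have "4 / l * dist z z' \<le> 4 * N" using x by simp
  ultimately show ?thesis by (auto elim: qh_joined_mono)
qed

text \<open>Every boundary point reaches the corner v by two segments, each inside a face. Both
  directions are recorded because \<open>qh_joined\<close> is stated for directed curves.\<close>

lemma qh_joined_frontier_cube:
  assumes x: "whitney x l" and b: "b \<in> frontier (cube x l)" "b' \<in> frontier (cube x l)"
  shows "qh_joined D (100 * N) b b'"
proof -
  define v :: "real ^ 'n::{finite,linorder}" where "v = (\<chi> i. x $ i + l / 2)"
  have v: "v \<in> cube x l" using x by (simp add: v_def mem_cube)
  have "qh_joined D (50 * N) b v \<and> qh_joined D (50 * N) v b" if b: "b \<in> frontier (cube x l)" for b
  proof -
    obtain i where i: "\<bar>b $ i - x $ i\<bar> = l / 2" and bc: "b \<in> cube x l"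
      using b by (auto simp: frontier_cube)
    \<comment> \<open>A second coordinate exists because n \<ge> 2. The intermediate point c then
      shares the face of b in coordinate i and a face with v in coordinate j.\<close>
    obtain j where j: "j \<noteq> i"
    proof -
      have "(UNIV :: 'n set) \<noteq> {i}"
      proof
        assume "(UNIV :: 'n set) = {i}"
        then have "CARD('n) = card {i}" by (rule arg_cong)
        with card_ge_2 show False by simp
      qed
      then show ?thesis using that by blast
    qed
    define c :: "real ^ 'n::{finite,linorder}" where "c = (\<chi> k. if k = i then b $ i else x $ k + l / 2)"
    have c: "c \<in> cube x l" using x i by (auto simp: c_def mem_cube)
    have 1: "c $ i = b $ i" "\<bar>c $ i - x $ i\<bar> = l / 2" using i by (auto simp: c_def)
    have 2: "v $ j = c $ j" "\<bar>v $ j - x $ j\<bar> = l / 2" "\<bar>c $ j - x $ j\<bar> = l / 2"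
      using x j by (auto simp: c_def v_def)
    have "qh_joined D (25 * N + 25 * N) b v"
      using qh_joined_in_face[OF x bc c i 1(1)] qh_joined_in_face[OF x c v 2(3) 2(1)]
      by (rule qh_joined_trans)
    moreover have "qh_joined D (25 * N + 25 * N) v b"
      using qh_joined_in_face[OF x v c 2(2) 2(1)[symmetric]] qh_joined_in_face[OF x c bc 1(2) 1(1)[symmetric]]
      by (rule qh_joined_trans)
    ultimately show ?thesis by simp
  qed
  then have "qh_joined D (50 * N + 50 * N) b b'"
    using b qh_joined_trans by blast
  then show ?thesis by simp
qed

text \<open>The factor 20 N makes dist p q at most l / 4 and at most l' / 2, below both sides, so
  the dyadic cubes meet. If they differ, a common point lies on both boundaries and links b to
  b'.\<close>

lemma qh_joined_close_cubes:
  assumes x: "whitney x l" "whitney x' l'" and p: "p \<in> cube x l" "q \<in> cube x' l'"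
    and pq: "dist p q \<le> \<delta> p / (20 * N)"
    and b: "b \<in> frontier (cube x l)" "b' \<in> frontier (cube x' l')"
  shows "qh_joined D (200 * N) b b'"
proof -
  have N: "N > 0" using N_ge_1 by linarith
  have 1: "\<delta> p / (20 * N) \<le> l / 4"
    using \<delta>_le[OF x(1) p(1)] N by (simp add: field_simps)
  have "\<delta> p / (20 * N) \<le> \<delta> p / 20"
    using N_ge_1 by (intro divide_left_mono) (auto simp: infdist_nonneg)
  then have "\<delta> p \<le> 2 * \<delta> q"
    using infdist_triangle[of p "frontier G" q] pq infdist_nonneg[of p "frontier G"] by linarith
  then have "\<delta> p / (20 * N) \<le> (10 * N * l') / (20 * N)"
    using \<delta>_le[OF x(2) p(2)] N by (intro divide_right_mono) auto
  then have 2: "\<delta> p / (20 * N) \<le> l' / 2" using N by simp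
  have "cube x l \<inter> cube x' l' \<noteq> {}"
    using W x p pq 1 2 by (intro dyadic_cubes_meet[of x l x' l' p q]) (auto simp: whitney_decomposition_def)
  then obtain v where v: "v \<in> cube x l" "v \<in> cube x' l'" by blast
  show ?thesis
  proof (cases "cube x l = cube x' l'")
    case True
    then show ?thesis
      using qh_joined_frontier_cube[OF x(1) b(1)] b(2) qh_joined_mono[of D "100 * N" b b' "200 * N"] N by simp
  next
    case False
    have "closed (cube x l)" for x :: "real ^ 'n::{finite,linorder}" and l by (simp add: cube_eq_cbox closed_cbox)
    then have "v \<in> frontier (cube x l)" "v \<in> frontier (cube x' l')"
      using notin_interior_other[OF x False v(1)] notin_interior_other[OF x(2,1) False[symmetric] v(2)] v
      by (auto simp: frontier_def)
    then have "qh_joined D (100 * N + 100 * N) b b'"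
      using qh_joined_frontier_cube x b by (blast intro: qh_joined_trans)
    then show ?thesis by simp
  qed
qed

end

section \<open>Leaving an apartment\<close>

definition axis_point :: "real ^ 'n::{finite,linorder} \<Rightarrow> real \<Rightarrow> real ^ 'n::{finite,linorder}" where
  "axis_point x h = x + h *\<^sub>R axis last_index 1"

lemma axis_point_nth: "axis_point x h $ i = x $ i + (if i = last_index then h else 0)"
  by (simp add: axis_point_def axis_def)

context whitney_apartments
begin

text \<open>A cone condition costs only logarithmically much: along the segment, the distance to the
  boundary is at least both \<open>\<delta>\<^sub>D z - u\<close> and \<open>u / N\<close>, hence at least \<open>(\<delta>\<^sub>D z + u) / (2 N + 1)\<close>.\<close>

lemma qh_joined_cone:
  assumes x: "whitney x l" and zD: "z \<in> D" and z: "z \<in> cube x l" "z' \<in> cube x l"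
    and bound: "\<And>\<tau> w. \<tau> \<in> {0..1} \<Longrightarrow> w \<in> wall \<beta> x l \<Longrightarrow> \<tau> * dist z z' / N \<le> dist (z + \<tau> *\<^sub>R (z' - z)) w"
  shows "qh_joined D (21 * N + (2 * N + 1) * ln ((\<delta>\<^sub>D z + N * l) / \<delta>\<^sub>D z)) z z'"
proof -
  define d U B where "d = \<delta>\<^sub>D z" and "U = dist z z'" and "B = 2 * N + 1"
  have d: "0 < d" using \<delta>\<^sub>D_pos[OF zD] by (simp add: d_def)
  have N: "0 < N" using N_ge_1 by linarith
  then have B: "0 < B" by (simp add: B_def)
  have U: "0 \<le> U" "U \<le> N * l" using dist_cube_le[of l z x z'] x z by (auto simp: U_def)
  have "((\<lambda>u. 1 / ((d + u) / B)) has_integral B * ln ((d + U) / d)) {0..dist z z'}"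
    using has_integral_const_plus_inverse[of d U 0 B] d U by (simp add: U_def)
  then have "qh_joined D (21 * N + B * ln ((d + U) / d)) z z'"
  proof (rule qh_joined_in_cube[OF x z, rotated 3])
    fix u assume "u \<in> {0..dist z z'}"
    then show "0 < (d + u) / B" using d B by simp
  next
    fix \<tau> :: real assume \<tau>: "\<tau> \<in> {0..1}"
    let ?y = "z + \<tau> *\<^sub>R (z' - z)"
    show "?y \<in> D"
    \<comment> \<open>At a point that has not moved the cone bound is only 0 and excludes no wall;
      there z \<in> D is used.\<close>
    proof (cases "?y = z")
      case False
      then have "\<tau> * dist z z' / N \<noteq> 0" using N by auto
      then have "0 < \<tau> * dist z z' / N" using \<tau> N by (simp add: order_less_le)
      then show ?thesis
        using bound[OF \<tau>, of ?y] by (intro mem_DI[OF x segment_in_cube[OF z \<tau>]]) auto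
    qed (use zD in metis)
    define u where "u = \<tau> * dist z z'"
    have u: "0 \<le> u" "dist z ?y = u" using \<tau> by (auto simp: u_def dist_norm norm_minus_commute)
    have 1: "d - u \<le> \<delta>\<^sub>D ?y"
      using infdist_triangle[of z "frontier D" ?y] u by (simp add: d_def)
    have 2: "min (l / 21) (u / N) \<le> \<delta>\<^sub>D ?y"
      using bound[OF \<tau>] by (intro \<delta>\<^sub>D_ge[OF x segment_in_cube[OF z \<tau>]]) (auto simp: u_def simp del: le_divide_eq_numeral1 intro: min.coboundedI2)
    have "min (l / 21) ((d + u) / B) \<le> \<delta>\<^sub>D ?y"
    proof (cases "(d + u) / B \<le> u / N")
      case True
      then have "min (l / 21) ((d + u) / B) \<le> min (l / 21) (u / N)" by (intro min.mono) auto
      with 2 show ?thesis by linarith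
    next
      case False
      then have "u * B < (d + u) * N" using N B by (simp add: field_simps)
      then have "(d + u) \<le> (d - u) * B" by (simp add: B_def algebra_simps)
      then have "(d + u) / B \<le> d - u" using B by (simp add: field_simps)
      with 1 show ?thesis by linarith
    qed
    then show "min (l / 21) ((d + \<tau> * dist z z') / B) \<le> \<delta>\<^sub>D ?y" by (simp add: u_def)
  qed
  moreover have "B * ln ((d + U) / d) \<le> B * ln ((d + N * l) / d)"
    using B d U by (intro mult_left_mono ln_mono divide_right_mono) (auto intro!: divide_pos_pos add_pos_nonneg)
  ultimately show ?thesis
    unfolding d_def B_def by (auto elim: qh_joined_mono)
qed

text \<open>A direction with entries at most 1 in absolute value has Euclidean norm at most N.
  Clearance u at time u is therefore the cone condition with constant N.\<close>

lemma qh_joined_direction: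
  assumes x: "whitney x l" and zD: "z \<in> D" and z: "z \<in> cube x l" "z + T *\<^sub>R v \<in> cube x l"
    and T: "0 \<le> T" and v: "\<And>i. \<bar>v $ i\<bar> \<le> 1"
    and bound: "\<And>u w. 0 \<le> u \<Longrightarrow> u \<le> T \<Longrightarrow> w \<in> wall \<beta> x l \<Longrightarrow> u \<le> dist (z + u *\<^sub>R v) w"
  shows "qh_joined D (21 * N + (2 * N + 1) * ln ((\<delta>\<^sub>D z + N * l) / \<delta>\<^sub>D z)) z (z + T *\<^sub>R v)"
proof (rule qh_joined_cone[OF x zD z])
  fix \<tau> :: real and w assume \<tau>: "\<tau> \<in> {0..1}" and w: "w \<in> wall \<beta> x l"
  have N: "0 < N" using N_ge_1 by linarith
  have "norm v \<le> N"
    using dist_le_sqrt_card[of v 0 1] v by (simp add: N_eq)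
  then have "\<tau> * dist z (z + T *\<^sub>R v) / N \<le> \<tau> * (T * N) / N"
    using \<tau> T N by (intro divide_right_mono mult_left_mono) (auto simp: dist_norm mult_left_mono)
  also have "\<dots> = \<tau> * T" using N by simp
  also have "\<dots> \<le> dist (z + (\<tau> * T) *\<^sub>R v) w"
    using \<tau> T w by (intro bound) (auto simp: mult_left_le_one_le)
  finally show "\<tau> * dist z (z + T *\<^sub>R v) / N \<le> dist (z + \<tau> *\<^sub>R (z + T *\<^sub>R v - z)) w" by simp
qed

text \<open>The three bounds come from clauses 5, 3 and 4 of \<open>wallD\<close>. The first serves
  the whole upper axis, the second the part above the passage, the third the part inside the
  room.\<close>

lemma dist_axis_wall:
  assumes x: "whitney x l" and w: "w \<in> wall \<beta> x l" and r: "r = (l / 8) powr (1 / \<beta>)" and h: "0 \<le> h"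
  shows "r \<le> dist (axis_point x h) w" "h - l / 8 - r \<le> dist (axis_point x h) w"
    "l / 8 - h \<le> dist (axis_point x h) w"
proof -
  have rl: "r \<le> l / 8" and l: "0 < l" using passage_width[OF x] r x by auto
  note w' = wallD[OF w l r rl]
  have n: "\<bar>x $ last_index + h - w $ last_index\<bar> \<le> dist (axis_point x h) w"
    using component_le_dist[of "axis_point x h" last_index w] by (simp add: axis_point_nth)
  have i: "\<bar>x $ i - w $ i\<bar> \<le> dist (axis_point x h) w" if "i \<noteq> last_index" for i
    using component_le_dist[of "axis_point x h" i w] that by (simp add: axis_point_nth)
  show "r \<le> dist (axis_point x h) w"
    using w'(5)
  proof
    assume "\<exists>i. i \<noteq> last_index \<and> r \<le> \<bar>w $ i - x $ i\<bar>"
    then obtain j where "j \<noteq> last_index" "r \<le> \<bar>w $ j - x $ j\<bar>" by blast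
    then show ?thesis using i[of j] by linarith
  next
    assume "w $ last_index = x $ last_index - l / 8"
    then show ?thesis using n h rl by linarith
  qed
  show "h - l / 8 - r \<le> dist (axis_point x h) w"
    using n w'(3) by linarith
  obtain j where j: "l / 8 \<le> \<bar>w $ j - x $ j\<bar>" using w'(4) by blast
  show "l / 8 - h \<le> dist (axis_point x h) w"
  proof (cases "j = last_index")
    case True
    then have "l / 8 \<le> \<bar>w $ last_index - x $ last_index\<bar>" using j by simp
    then show ?thesis using n h by linarith
  next
    case False
    then show ?thesis using i[OF False] j h by linarith
  qed
qed

lemma qh_joined_axis:
  assumes x: "whitney x l" and h: "0 \<le> h" "h \<le> h'" "h' \<le> l / 2"
    and pos: "\<And>u. u \<in> {0..h' - h} \<Longrightarrow> 0 < f u"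
    and bound: "\<And>u w. u \<in> {0..h' - h} \<Longrightarrow> w \<in> wall \<beta> x l \<Longrightarrow> f u \<le> dist (axis_point x (h + u)) w"
    and int: "((\<lambda>u. 1 / f u) has_integral K) {0..h' - h}"
  shows "qh_joined D (21 * N + K) (axis_point x h) (axis_point x h')"
proof -
  have d: "dist (axis_point x h) (axis_point x h') = h' - h"
    using h(2) by (simp add: axis_point_def dist_norm norm_axis_1 flip: scaleR_diff_left)
  have p: "axis_point x h + \<tau> *\<^sub>R (axis_point x h' - axis_point x h) = axis_point x (h + \<tau> * (h' - h))" for \<tau>
    by (simp add: axis_point_def algebra_simps)
  have c: "axis_point x t \<in> cube x l" if "0 \<le> t" "t \<le> l / 2" for t
    using that x by (auto simp: mem_cube axis_point_nth)
  show ?thesis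
  proof (rule qh_joined_off_walls[OF x c c])
    show "((\<lambda>u. 1 / f u) has_integral K) {0..dist (axis_point x h) (axis_point x h')}"
      using int by (simp add: d)
    show "0 < f u" if "u \<in> {0..dist (axis_point x h) (axis_point x h')}" for u
      using that pos by (simp add: d)
    fix \<tau> :: real and w assume "\<tau> \<in> {0..1}" "w \<in> wall \<beta> x l"
    then show "f (\<tau> * dist (axis_point x h) (axis_point x h'))
      \<le> dist (axis_point x h + \<tau> *\<^sub>R (axis_point x h' - axis_point x h)) w"
      unfolding p d using h by (intro bound) (auto simp: mult_left_le_one_le)
  qed (use h in auto)
qed

text \<open>The quotient is at most 9 (l / 8) / r, and - ln r = ln (8 / l) / \<beta>. This is where
  the narrowness of the passage produces the factor 1 / \<beta>; the summand ln (l / 8) \<le> 0 is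
  dropped.\<close>

lemma passage_mouth_cost:
  assumes x: "whitney x l" and r: "r = (l / 8) powr (1 / \<beta>)" and "0 \<le> U" "U \<le> 3 * (l / 8)"
  shows "3 / 2 * ln ((r / 2 + U) / (r / 2)) \<le> 3 / 2 * (ln 9 + ln (8 / l) / \<beta>)"
proof -
  have r0: "0 < r" "r \<le> l / 8" and l: "0 < l" "l \<le> 4" using passage_width[OF x] r x side_le_4[OF x] by auto
  have "ln ((r / 2 + U) / (r / 2)) \<le> ln (9 * (l / 8) / r)"
  proof (rule ln_mono)
    show "0 < (r / 2 + U) / (r / 2)" using r0(1) assms(3) by (intro divide_pos_pos) linarith+
    have "(r / 2 + U) / (r / 2) = 1 + 2 * U / r" using r0 by (simp add: field_simps)
    also have "\<dots> = (r + 2 * U) / r" using r0 by (simp add: field_simps)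
    also have "\<dots> \<le> 9 * (l / 8) / r" using r0 assms(3,4) by (intro divide_right_mono) auto
    finally show "(r / 2 + U) / (r / 2) \<le> 9 * (l / 8) / r" .
  qed
  also have "\<dots> = ln 9 + ln (l / 8) - ln r"
  proof -
    have "ln (9 * (l / 8) / r) = ln (9 * (l / 8)) - ln r" using r0 l by (intro ln_divide_pos) auto
    moreover have "ln (9 * (l / 8)) = ln 9 + ln (l / 8)" using l by (intro ln_mult_pos) auto
    ultimately show ?thesis by linarith
  qed
  also have "ln r = - (ln (8 / l) / \<beta>)"
    unfolding r using l by (simp add: ln_powr ln_div diff_divide_distrib)
  also have "ln (l / 8) \<le> 0" using l by simp
  finally show ?thesis by simp
qed

text \<open>The left side is the convex combination r / 3 + 2 u / 3 of two lower bounds. The slope 2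
  / 3 gives each of the two crossings the factor 3 / 2, together 3 / \<beta>, which leaves 1 /
  \<beta> of the total 4 / \<beta> for the John curve.\<close>

lemma two_thirds_le: "r \<le> t \<Longrightarrow> u \<le> t \<Longrightarrow> 2 / 3 * (r / 2 + u) \<le> (t::real)"
proof -
  have "2 / 3 * (r / 2 + u) = r / 3 + 2 * u / 3" by (simp add: field_simps)
  then show "r \<le> t \<Longrightarrow> u \<le> t \<Longrightarrow> 2 / 3 * (r / 2 + u) \<le> t" by linarith
qed

text \<open>At height u the wall is at distance at least r and at least l / 8 - u. The bound is
  smallest at the mouth, the end of the segment, hence the reflected integral.\<close>

lemma qh_joined_center_mouth:
  assumes x: "whitney x l"
  shows "qh_joined D (21 * N + 3 / 2 * (ln 9 + ln (8 / l) / \<beta>)) (axis_point x 0) (axis_point x (l / 8))"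
proof -
  define r where "r = (l / 8) powr (1 / \<beta>)"
  have r0: "0 < r" and l: "0 < l" using passage_width[OF x] r_def x by auto
  have "((\<lambda>u. 1 / (2 / 3 * (r / 2 + (l / 8 - u)))) has_integral 3 / 2 * ln ((r / 2 + l / 8) / (r / 2))) {0..l / 8 - 0}"
    using has_integral_const_plus_inverse_reflected[of "r / 2" "l / 8" 0 "3 / 2"] r0 l by simp
  then have "qh_joined D (21 * N + 3 / 2 * ln ((r / 2 + l / 8) / (r / 2))) (axis_point x 0) (axis_point x (l / 8))"
  proof (rule qh_joined_axis[OF x, rotated 5])
    fix u w assume u: "u \<in> {0..l / 8 - 0}" and w: "w \<in> wall \<beta> x l"
    then show "2 / 3 * (r / 2 + (l / 8 - u)) \<le> dist (axis_point x (0 + u)) w"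
      using dist_axis_wall(1,3)[OF x w r_def, of u] by (intro two_thirds_le) auto
  qed (use r0 l in auto)
  moreover have "3 / 2 * ln ((r / 2 + l / 8) / (r / 2)) \<le> 3 / 2 * (ln 9 + ln (8 / l) / \<beta>)"
    using l by (intro passage_mouth_cost[OF x r_def]) auto
  ultimately show ?thesis by (auto elim: qh_joined_mono)
qed

text \<open>The rest of the passage has length at most r at distance at least r, so it adds at most
  1. Above it the distance grows with the height. The variable start h serves both the mouth and
  points already in the passage.\<close>

lemma qh_joined_passage_face:
  assumes x: "whitney x l" and r: "r = (l / 8) powr (1 / \<beta>)" and h: "l / 8 \<le> h" "h \<le> l / 8 + r"
  shows "qh_joined D (42 * N + 1 + 3 / 2 * (ln 9 + ln (8 / l) / \<beta>)) (axis_point x h) (axis_point x (l / 2))"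
proof -
  have r0: "0 < r" "r \<le> l / 8" and l: "0 < l" using passage_width[OF x] r x by auto
  have "((\<lambda>u. 1 / r) has_integral (l / 8 + r - h) / r) {0..l / 8 + r - h}"
    using has_integral_const_plus_inverse[of 1 "l / 8 + r - h" "1 / r" 0] h by simp
  then have "qh_joined D (21 * N + (l / 8 + r - h) / r) (axis_point x h) (axis_point x (l / 8 + r))"
  proof (rule qh_joined_axis[OF x, rotated 5])
    fix u w assume u: "u \<in> {0..l / 8 + r - h}" and w: "w \<in> wall \<beta> x l"
    then show "r \<le> dist (axis_point x (h + u)) w"
      using h l by (intro dist_axis_wall(1)[OF x w r]) auto
  qed (use r0 l h in auto)
  moreover define U where "U = l / 2 - (l / 8 + r)"
  have U: "0 \<le> U" "U \<le> 3 * (l / 8)" using r0 l by (auto simp: U_def)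
  have "((\<lambda>u. 1 / (2 / 3 * (r / 2 + u))) has_integral 3 / 2 * ln ((r / 2 + U) / (r / 2))) {0..l / 2 - (l / 8 + r)}"
    using has_integral_const_plus_inverse[of "r / 2" U 0 "3 / 2"] r0 U(1) by (simp flip: U_def)
  then have "qh_joined D (21 * N + 3 / 2 * ln ((r / 2 + U) / (r / 2))) (axis_point x (l / 8 + r)) (axis_point x (l / 2))"
  proof (rule qh_joined_axis[OF x, rotated 5])
    fix u w assume u: "u \<in> {0..l / 2 - (l / 8 + r)}" and w: "w \<in> wall \<beta> x l"
    then show "2 / 3 * (r / 2 + u) \<le> dist (axis_point x (l / 8 + r + u)) w"
      using dist_axis_wall(1,2)[OF x w r, of "l / 8 + r + u"] l r0 by (intro two_thirds_le) auto
  qed (use r0 l in auto)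
  ultimately have "qh_joined D (21 * N + (l / 8 + r - h) / r + (21 * N + 3 / 2 * ln ((r / 2 + U) / (r / 2))))
      (axis_point x h) (axis_point x (l / 2))"
    by (rule qh_joined_trans)
  moreover have "(l / 8 + r - h) / r \<le> 1" using h r0 by simp
  ultimately show ?thesis
    using passage_mouth_cost[OF x r U] by (elim qh_joined_mono) linarith
qed

text \<open>Every position in the cube allows a motion that recedes from the walls linearly. Points
  in the room or passage move to the axis and leave along it, paying the term with ln (8 / l) /
  \<beta>; all others go straight to the boundary of the cube.\<close>

lemma qh_joined_escape:
  assumes x: "whitney x l" and zD: "z \<in> D" and z: "z \<in> cube x l"
  shows "\<exists>b \<in> frontier (cube x l).
    qh_joined D (84 * N + 1 + 3 * (ln 9 + ln (8 / l) / \<beta>) + (2 * N + 1) * ln ((\<delta>\<^sub>D z + N * l) / \<delta>\<^sub>D z)) z b"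
    (is "\<exists>b \<in> _. qh_joined D ?K z b")
proof -
  define r where "r = (l / 8) powr (1 / \<beta>)"
  define E where "E = ln 9 + ln (8 / l) / \<beta>"
  define C where "C = (2 * N + 1) * ln ((\<delta>\<^sub>D z + N * l) / \<delta>\<^sub>D z)"
  have K: "?K = 84 * N + 1 + 3 * E + C" by (simp add: E_def C_def)
  have r0: "0 < r" "r \<le> l / 8" and l: "0 < l" "l \<le> 4"
    using passage_width[OF x] r_def x side_le_4[OF x] by auto
  have N: "1 \<le> N" by (rule N_ge_1)
  have E: "0 \<le> E" unfolding E_def using l \<beta>_pos by (intro add_nonneg_nonneg divide_nonneg_pos) auto
  let ?n = "last_index :: 'n"
  note wD = wallD[OF _ l(1) r_def r0(2)]
  have top: "axis_point x (l / 2) \<in> frontier (cube x l)"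
    using l by (auto simp: frontier_cube mem_cube axis_point_nth)
  have zl: "\<bar>z $ i - x $ i\<bar> \<le> l / 2" for i using z by (simp only: mem_cube)
  \<comment> \<open>Common end of the four cases that reach the boundary directly; the nonnegative E
    absorbs the passage cost they do not incur.\<close>
  have direct: "\<exists>b \<in> frontier (cube x l). qh_joined D ?K z b"
    if "0 \<le> T" "\<And>i. \<bar>v $ i\<bar> \<le> 1" "z + T *\<^sub>R v \<in> frontier (cube x l)"
      "\<And>u w. 0 \<le> u \<Longrightarrow> u \<le> T \<Longrightarrow> w \<in> wall \<beta> x l \<Longrightarrow> u \<le> dist (z + u *\<^sub>R v) w" for T v
  proof -
    have "z + T *\<^sub>R v \<in> cube x l" using that(3) by (simp add: frontier_cube)
    then have "qh_joined D (21 * N + C) z (z + T *\<^sub>R v)"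
      unfolding C_def using qh_joined_direction[OF x zD z _ that(1,2,4)] by blast
    then have "qh_joined D ?K z (z + T *\<^sub>R v)"
      unfolding K by (rule qh_joined_mono) (use E N in linarith)
    then show ?thesis using that(3) by blast
  qed
  \<comment> \<open>The room case is strict in every coordinate, so a point at ceiling height is
    treated as passage, corner or side.\<close>
  consider (room) "\<And>i. \<bar>z $ i - x $ i\<bar> < l / 8"
    | (passage) "\<And>i. i \<noteq> ?n \<Longrightarrow> \<bar>z $ i - x $ i\<bar> < r" "l / 8 \<le> z $ ?n - x $ ?n" "z $ ?n - x $ ?n \<le> l / 8 + r"
    | (above) "l / 8 + r < z $ ?n - x $ ?n"
    | (below) "z $ ?n - x $ ?n \<le> - (l / 8)"
    | (side) i where "i \<noteq> ?n" "l / 8 \<le> \<bar>z $ i - x $ i\<bar>"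
    | (corner) i where "i \<noteq> ?n" "r \<le> \<bar>z $ i - x $ i\<bar>" "\<bar>z $ i - x $ i\<bar> < l / 8" "l / 8 \<le> z $ ?n - x $ ?n"
  proof (cases "z $ ?n - x $ ?n \<le> - (l / 8) \<or> l / 8 + r < z $ ?n - x $ ?n \<or>
      (\<exists>i. i \<noteq> ?n \<and> l / 8 \<le> \<bar>z $ i - x $ i\<bar>)")
    case True
    then show ?thesis using above below side by blast
  next
    case False
    then have F: "- (l / 8) < z $ ?n - x $ ?n" "z $ ?n - x $ ?n \<le> l / 8 + r"
      "\<And>i. i \<noteq> ?n \<Longrightarrow> \<bar>z $ i - x $ i\<bar> < l / 8"
      by (auto simp: not_le not_less simp del: le_divide_eq_numeral1 divide_less_eq_numeral1 divide_le_eq_numeral1 less_divide_eq_numeral1)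
    show ?thesis
    proof (cases "z $ ?n - x $ ?n < l / 8")
      case True
      then have "\<bar>z $ ?n - x $ ?n\<bar> < l / 8" using F(1) by linarith
      then show ?thesis using room F(3) by metis
    next
      case False
      then have F': "l / 8 \<le> z $ ?n - x $ ?n" by linarith
      show ?thesis
      proof (cases "\<forall>i. i \<noteq> ?n \<longrightarrow> \<bar>z $ i - x $ i\<bar> < r")
        case True
        then show ?thesis using passage F(2) F' by blast
      next
        case False
        then obtain i where "i \<noteq> ?n" "r \<le> \<bar>z $ i - x $ i\<bar>" by (meson not_le)
        then show ?thesis using corner F(3) F' by blast
      qed
    qed
  qed
  then show ?thesis
  proof cases
    case room
    have "qh_joined D (21 * N + C) z (axis_point x 0)"
      unfolding C_def
    proof (rule qh_joined_cone[OF x zD z])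
      show "axis_point x 0 \<in> cube x l" using l by (simp add: mem_cube axis_point_def)
      fix \<tau> :: real and w assume \<tau>: "\<tau> \<in> {0..1}" and w: "w \<in> wall \<beta> x l"
      let ?y = "z + \<tau> *\<^sub>R (axis_point x 0 - z)"
      have "dist z (axis_point x 0) \<le> N * (l / 8)"
        unfolding N_eq using room by (intro dist_le_sqrt_card) (simp add: axis_point_def less_imp_le)
      then have "\<tau> * dist z (axis_point x 0) / N \<le> \<tau> * (N * (l / 8)) / N"
        using \<tau> N by (intro divide_right_mono mult_left_mono) auto
      also have "\<dots> = \<tau> * (l / 8)" using N by simp
      also have "\<dots> \<le> dist ?y w"
      proof -
        \<comment> \<open>Shrinking towards the centre brings every coordinate of the point below (1
          - \<tau>) l / 8, while each wall point has some coordinate of size at least l / 8.\<close>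
        obtain j where j: "l / 8 \<le> \<bar>w $ j - x $ j\<bar>" using wD(4)[OF w] by blast
        have "?y $ j - x $ j = (1 - \<tau>) * (z $ j - x $ j)" by (simp add: axis_point_def algebra_simps)
        then have "\<bar>?y $ j - x $ j\<bar> = (1 - \<tau>) * \<bar>z $ j - x $ j\<bar>" using \<tau> by (simp add: abs_mult)
        also have "\<dots> \<le> (1 - \<tau>) * (l / 8)" using \<tau> room[of j] by (intro mult_left_mono) auto
        finally have "\<bar>?y $ j - x $ j\<bar> \<le> l / 8 - \<tau> * (l / 8)" by (simp add: algebra_simps)
        then show ?thesis using j component_le_dist[of ?y j w] by linarith
      qed
      finally show "\<tau> * dist z (axis_point x 0) / N \<le> dist ?y w" .
    qed
    from qh_joined_trans[OF qh_joined_trans[OF this qh_joined_center_mouth[OF x]] qh_joined_passage_face[OF x r_def]]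
    have "qh_joined D (21 * N + C + (21 * N + 3 / 2 * E) + (42 * N + 1 + 3 / 2 * E)) z (axis_point x (l / 2))"
      using r0 by (simp add: E_def)
    then have "qh_joined D ?K z (axis_point x (l / 2))"
      unfolding K by (rule qh_joined_mono) (use E N in linarith)
    then show ?thesis using top by blast
  next
    case passage
    define h where "h = z $ ?n - x $ ?n"
    have "qh_joined D (21 * N + C) z (axis_point x h)"
      unfolding C_def
    proof (rule qh_joined_cone[OF x zD z])
      show "axis_point x h \<in> cube x l" using l zl[of ?n] by (simp add: mem_cube axis_point_nth h_def)
      fix \<tau> :: real and w assume \<tau>: "\<tau> \<in> {0..1}" and w: "w \<in> wall \<beta> x l"
      let ?y = "z + \<tau> *\<^sub>R (axis_point x h - z)"
      have "dist z (axis_point x h) \<le> N * r"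
        unfolding N_eq using passage(1) r0 by (intro dist_le_sqrt_card) (simp add: axis_point_nth h_def less_imp_le)
      then have "\<tau> * dist z (axis_point x h) / N \<le> \<tau> * (N * r) / N"
        using \<tau> N by (intro divide_right_mono mult_left_mono) auto
      also have "\<dots> = \<tau> * r" using N by simp
      also have "\<dots> \<le> dist ?y w"
        using wD(5)[OF w]
      proof
        assume "\<exists>i. i \<noteq> ?n \<and> r \<le> \<bar>w $ i - x $ i\<bar>"
        then obtain j where j: "j \<noteq> ?n" "r \<le> \<bar>w $ j - x $ j\<bar>" by blast
        have "?y $ j - x $ j = (1 - \<tau>) * (z $ j - x $ j)" using j by (simp add: axis_point_nth algebra_simps)
        then have "\<bar>?y $ j - x $ j\<bar> = (1 - \<tau>) * \<bar>z $ j - x $ j\<bar>" using \<tau> by (simp add: abs_mult)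
        also have "\<dots> \<le> (1 - \<tau>) * r" using \<tau> passage(1)[of j] j by (intro mult_left_mono) auto
        finally have "\<bar>?y $ j - x $ j\<bar> \<le> r - \<tau> * r" by (simp add: algebra_simps)
        then show ?thesis using j component_le_dist[of ?y j w] by linarith
      next
        \<comment> \<open>A floor point is at least l / 4 lower, which exceeds r and hence \<tau>
          r.\<close>
        assume "w $ ?n = x $ ?n - l / 8"
        moreover have "?y $ ?n = z $ ?n" by (simp add: axis_point_nth h_def)
        ultimately have "r \<le> dist ?y w"
          using passage(2) r0 l component_le_dist[of ?y ?n w] by linarith
        moreover have "\<tau> * r \<le> r" using \<tau> r0 by (simp add: mult_left_le_one_le)
        ultimately show ?thesis by linarith
      qed
      finally show "\<tau> * dist z (axis_point x h) / N \<le> dist ?y w" .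
    qed
    from qh_joined_trans[OF this qh_joined_passage_face[OF x r_def]]
    have "qh_joined D (21 * N + C + (42 * N + 1 + 3 / 2 * E)) z (axis_point x (l / 2))"
      using passage by (simp add: E_def h_def)
    then have "qh_joined D ?K z (axis_point x (l / 2))"
      unfolding K by (rule qh_joined_mono) (use E N in linarith)
    then show ?thesis using top by blast
  next
    case above
    show ?thesis
    proof (rule direct[of "x $ ?n + l / 2 - z $ ?n" "axis ?n 1"])
      show "0 \<le> x $ ?n + l / 2 - z $ ?n" using zl[of ?n] by linarith
      show "\<bar>axis ?n 1 $ i\<bar> \<le> (1::real)" for i by (simp add: axis_def)
      show "z + (x $ ?n + l / 2 - z $ ?n) *\<^sub>R axis ?n 1 \<in> frontier (cube x l)"
        using zl l unfolding frontier_cube mem_cube mem_Collect_eq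
        by (auto simp: axis_def intro!: exI[of _ ?n])
      fix u :: real and w assume u: "0 \<le> u" and w: "w \<in> wall \<beta> x l"
      have "(z + u *\<^sub>R axis ?n 1) $ ?n = z $ ?n + u" by (simp add: axis_def)
      then show "u \<le> dist (z + u *\<^sub>R axis ?n 1) w"
        using component_le_dist[of "z + u *\<^sub>R axis ?n 1" ?n w] wD(3)[OF w] above by linarith
    qed
  next
    case below
    show ?thesis
    proof (rule direct[of "z $ ?n - (x $ ?n - l / 2)" "- axis ?n 1"])
      show "0 \<le> z $ ?n - (x $ ?n - l / 2)" using zl[of ?n] by linarith
      show "\<bar>(- axis ?n 1) $ i\<bar> \<le> (1::real)" for i by (simp add: axis_def)
      show "z + (z $ ?n - (x $ ?n - l / 2)) *\<^sub>R - axis ?n 1 \<in> frontier (cube x l)"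
        using zl l unfolding frontier_cube mem_cube mem_Collect_eq
        by (auto simp: axis_def intro!: exI[of _ ?n])
      fix u :: real and w assume u: "0 \<le> u" and w: "w \<in> wall \<beta> x l"
      have "(z + u *\<^sub>R - axis ?n 1) $ ?n = z $ ?n - u" by (simp add: axis_def)
      then show "u \<le> dist (z + u *\<^sub>R - axis ?n 1) w"
        using component_le_dist[of "z + u *\<^sub>R - axis ?n 1" ?n w] wD(2)[OF w] below by linarith
    qed
  next
    case (side i)
    \<comment> \<open>The sign for which moving along coordinate i increases the distance from the
      centre plane at unit speed.\<close>
    define \<sigma> :: real where "\<sigma> = (if x $ i \<le> z $ i then 1 else - 1)"
    have \<sigma>: "\<sigma> * \<sigma> = 1" "\<bar>\<sigma>\<bar> = 1" "z $ i - x $ i = \<sigma> * \<bar>z $ i - x $ i\<bar>" by (auto simp: \<sigma>_def)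
    define T where "T = l / 2 - \<bar>z $ i - x $ i\<bar>"
    have mv: "(z + u *\<^sub>R (\<sigma> *\<^sub>R axis i 1)) $ i - x $ i = \<sigma> * (\<bar>z $ i - x $ i\<bar> + u)" for u
      using \<sigma>(3) by (simp add: axis_def algebra_simps)
    have mv': "(z + u *\<^sub>R (\<sigma> *\<^sub>R axis i 1)) $ j = z $ j" if "j \<noteq> i" for u j
      using that by (simp add: axis_def)
    have av: "\<bar>(z + u *\<^sub>R (\<sigma> *\<^sub>R axis i 1)) $ i - x $ i\<bar> = \<bar>z $ i - x $ i\<bar> + u" if "0 \<le> u" for u
      unfolding mv using that \<sigma>(2) by (simp add: abs_mult)
    show ?thesis
    proof (rule direct[of T "\<sigma> *\<^sub>R axis i 1"])
      show T: "0 \<le> T" using zl[of i] by (simp add: T_def)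
      show "\<bar>(\<sigma> *\<^sub>R axis i 1) $ j\<bar> \<le> (1::real)" for j using \<sigma>(2) by (simp add: axis_def)
      have "\<bar>(z + T *\<^sub>R (\<sigma> *\<^sub>R axis i 1)) $ j - x $ j\<bar> \<le> l / 2" for j
      proof (cases "j = i")
        case True
        then show ?thesis using av[OF T] by (simp add: T_def)
      next
        case False
        then show ?thesis using mv'[OF False, of T] zl[of j] by (simp only:)
      qed
      moreover have "\<bar>(z + T *\<^sub>R (\<sigma> *\<^sub>R axis i 1)) $ i - x $ i\<bar> = l / 2"
        using av[OF T] by (simp add: T_def)
      ultimately show "z + T *\<^sub>R (\<sigma> *\<^sub>R axis i 1) \<in> frontier (cube x l)"
        unfolding frontier_cube mem_cube by blast
      fix u :: real and w assume u: "0 \<le> u" and w: "w \<in> wall \<beta> x l"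
      show "u \<le> dist (z + u *\<^sub>R (\<sigma> *\<^sub>R axis i 1)) w"
        using component_le_dist[of "z + u *\<^sub>R (\<sigma> *\<^sub>R axis i 1)" i w] wD(1)[OF w side(1)] side(2) av[OF u] by linarith
    qed
  next
    case (corner i)
    define \<sigma> :: real where "\<sigma> = (if x $ i \<le> z $ i then 1 else - 1)"
    have \<sigma>: "\<sigma> * \<sigma> = 1" "\<bar>\<sigma>\<bar> = 1" "z $ i - x $ i = \<sigma> * \<bar>z $ i - x $ i\<bar>" by (auto simp: \<sigma>_def)
    \<comment> \<open>Beside the passage and above the ceiling the motion is diagonal: going up
      recedes from everything at or below the ceiling, going outward recedes from the sides of the
      passage.\<close>
    define v :: "real ^ 'n::{finite,linorder}" where "v = axis ?n 1 + \<sigma> *\<^sub>R axis i 1"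
    define T where "T = l / 2 - (z $ ?n - x $ ?n)"
    have mv: "(z + u *\<^sub>R v) $ i - x $ i = \<sigma> * (\<bar>z $ i - x $ i\<bar> + u)" for u
      using \<sigma>(3) corner(1) by (simp add: v_def axis_def algebra_simps)
    have mv': "(z + u *\<^sub>R v) $ j = z $ j" if "j \<noteq> i" "j \<noteq> ?n" for u j
      using that by (simp add: v_def axis_def)
    have mn: "(z + u *\<^sub>R v) $ ?n = z $ ?n + u" for u
      using corner(1) by (simp add: v_def axis_def)
    have av: "\<bar>(z + u *\<^sub>R v) $ i - x $ i\<bar> = \<bar>z $ i - x $ i\<bar> + u" if "0 \<le> u" for u
      unfolding mv using that \<sigma>(2) by (simp add: abs_mult)
    show ?thesis
    proof (rule direct[of T v])
      show T: "0 \<le> T" using zl[of ?n] unfolding T_def by linarith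
      show "\<bar>v $ j\<bar> \<le> 1" for j using \<sigma>(2) corner(1) by (simp add: v_def axis_def)
      have n: "\<bar>(z + T *\<^sub>R v) $ ?n - x $ ?n\<bar> = l / 2"
        using l unfolding mn by (simp add: T_def)
      have "\<bar>(z + T *\<^sub>R v) $ j - x $ j\<bar> \<le> l / 2" for j
      proof -
        consider "j = i" | "j = ?n" | "j \<noteq> i" "j \<noteq> ?n" by blast
        then show ?thesis
        proof cases
          case 1
          \<comment> \<open>Here T \<le> 3 l / 8 and the initial offset is below l / 8, so the
            sideways motion stays within l / 2 until the top is reached.\<close>
          then show ?thesis using av[OF T] corner(3,4) unfolding T_def by simp
        next
          case 2
          then show ?thesis using n by simp
        next
          case 3
          then show ?thesis using mv'[OF 3, of T] zl[of j] by (simp only:)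
        qed
      qed
      then show "z + T *\<^sub>R v \<in> frontier (cube x l)"
        using n unfolding frontier_cube mem_cube by blast
      fix u :: real and w assume u: "0 \<le> u" and w: "w \<in> wall \<beta> x l"
      show "u \<le> dist (z + u *\<^sub>R v) w"
        using wD(6)[OF w]
      proof
        assume "w $ ?n \<le> x $ ?n + l / 8"
        then show ?thesis
          using component_le_dist[of "z + u *\<^sub>R v" ?n w] mn[of u] corner(4) by linarith
      next
        assume "\<forall>i. i \<noteq> ?n \<longrightarrow> \<bar>w $ i - x $ i\<bar> \<le> r"
        then have "\<bar>w $ i - x $ i\<bar> \<le> r" using corner(1) by blast
        then show ?thesis
          using component_le_dist[of "z + u *\<^sub>R v" i w] av[OF u] corner(2) by linarith
      qed
    qed
  qed
qed

end

section \<open>Following the John curve\<close>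

context whitney_apartments
begin

text \<open>Induction on the number of geometric steps. From t to at most t (1 + c / (20 N)) the
  curve moves at most c t / (20 N) \<le> \<delta> (\<gamma> t) / (20 N), just what
  \<open>qh_joined_close_cubes\<close> permits. The extra 1 pays for the passage to the given cube
  around the endpoint.\<close>

lemma qh_joined_john_curve:
  assumes \<gamma>: "arc_length_parametrized \<gamma> L" "\<gamma> ` {0..L} \<subseteq> G" and c: "0 < c"
    and john: "\<And>t. t \<in> {0..L} \<Longrightarrow> c * t \<le> \<delta> (\<gamma> t)"
    and x0: "whitney x0 l0" "\<gamma> L \<in> cube x0 l0" "b0 \<in> frontier (cube x0 l0)"
    and t: "0 < t" "t \<le> L" "L \<le> t * (1 + c / (20 * N)) ^ m"
    and x: "whitney x l" "\<gamma> t \<in> cube x l" "b \<in> frontier (cube x l)"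
  shows "qh_joined D (200 * N * (real m + 1)) b b0"
  using t x
proof (induction m arbitrary: t x l b)
  case 0
  then have "t = L" by simp
  then show ?case
    using qh_joined_close_cubes[OF 0(4) x0(1) 0(5) x0(2) _ 0(6) x0(3)] N_ge_1 by (simp add: infdist_nonneg)
next
  case (Suc m)
  define k where "k = 1 + c / (20 * N)"
  have k: "1 \<le> k" using c N_ge_1 by (simp add: k_def)
  \<comment> \<open>The next time, cut off at the end of the curve.\<close>
  define t' where "t' = min L (t * k)"
  have "t * 1 \<le> t * k" using k Suc.prems(1) by (intro mult_left_mono) auto
  then have t': "t \<le> t'" "t' \<le> L" "t' \<le> t * k" using Suc.prems by (auto simp: t'_def)
  then have "\<gamma> t' \<in> G" using \<gamma>(2) Suc.prems by auto
  then obtain x' l' where x': "whitney x' l'" "\<gamma> t' \<in> cube x' l'" using mem_G_iff by blast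
  define b' :: "real ^ 'n::{finite,linorder}" where "b' = (\<chi> i. x' $ i + l' / 2)"
  have b': "b' \<in> frontier (cube x' l')" using x'(1) by (simp add: b'_def frontier_cube mem_cube)
  have "L \<le> t' * k ^ m"
  proof (cases "L \<le> t * k")
    case True
    then have "t' = L" by (simp add: t'_def)
    moreover have "L * 1 \<le> L * k ^ m" using Suc.prems k by (intro mult_left_mono) auto
    ultimately show ?thesis by simp
  next
    case False
    then show ?thesis using Suc.prems(3) by (simp add: t'_def k_def mult_ac)
  qed
  then have 1: "qh_joined D (200 * N * (real m + 1)) b' b0"
    using t' Suc.prems(1) by (intro Suc.IH[OF _ t'(2) _ x' b']) (auto simp: k_def)
  have "dist (\<gamma> t) (\<gamma> t') \<le> t' - t"
    using lipschitz_onD[OF arc_length_parametrized_lipschitz[OF \<gamma>(1)], of t t'] t' Suc.prems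
    by (auto simp: dist_real_def)
  also have "\<dots> \<le> c * t / (20 * N)" using t'(3) by (simp add: k_def algebra_simps)
  also have "\<dots> \<le> \<delta> (\<gamma> t) / (20 * N)"
    using john[of t] Suc.prems N_ge_1 by (intro divide_right_mono) auto
  finally have "qh_joined D (200 * N) b b'"
    using qh_joined_close_cubes[OF Suc.prems(4) x'(1) Suc.prems(5) x'(2) _ Suc.prems(6) b'] by blast
  from qh_joined_trans[OF this 1] show ?case by (simp add: algebra_simps)
qed

text \<open>With e = c / (20 N), about (2 / e) ln (L / t) steps of cost 200 N suffice, and 200 N *
  40 N / c = 8000 n / c because N^2 = n. Since L / t is at most a constant over l, the logarithm is
  ln (4 / l) up to a constant C that is uniform over all cubes.\<close>

lemma qh_joined_john_center:
  assumes c: "0 < c" "c \<le> 1" and john: "john_condition G p0 c"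
    and x0: "whitney x0 l0" "p0 \<in> cube x0 l0" "b0 \<in> frontier (cube x0 l0)"
  shows "\<exists>C. \<forall>x l b. whitney x l \<and> b \<in> frontier (cube x l) \<longrightarrow>
    qh_joined D (8000 * real CARD('n) / c * ln (4 / l) + C) b b0"
proof -
  define e where "e = c / (20 * N)"
  define M where "M = 200 * N"
  define A where "A = M * (2 / e)"
  have N: "1 \<le> N" by (rule N_ge_1)
  have e: "0 < e" "e \<le> 1" using c N by (auto simp: e_def)
  have M: "0 < M" using N by (simp add: M_def)
  have A: "0 < A" using M e by (simp add: A_def)
  have A_eq: "A = 8000 * real CARD('n) / c"
  proof -
    have "N * N = real CARD('n)" by (simp add: N_eq)
    moreover have "A = 8000 * (N * N) / c" by (simp add: A_def M_def e_def)
    ultimately show ?thesis by simp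
  qed
  \<comment> \<open>The John condition at the end gives L \<le> \<delta> p0 / c, and the first time
    satisfies t \<ge> l / 20, so L / t \<le> R / l. The maximum with 1 keeps ln R
    nonnegative.\<close>
  define R where "R = max 1 (20 * \<delta> p0 / c)"
  define C where "C = A * ln R + 3 * M"
  have R: "0 \<le> ln R" "1 \<le> R" by (auto simp: R_def)
  have "qh_joined D (A * ln (4 / l) + C) b b0" if x: "whitney x l" and b: "b \<in> frontier (cube x l)" for x l b
  proof -
    have l: "0 < l" "l \<le> 4" using x side_le_4 by auto
    have l4: "0 \<le> ln (4 / l)" using l by simp
    have xc: "x \<in> cube x l" using l by (simp add: mem_cube)
    have "x \<in> G" using xc cube_subset_G[OF x] by blast
    from bspec[OF john[unfolded john_condition_def] this]
    obtain \<gamma> L where "arc_length_parametrized \<gamma> L \<and> \<gamma> ` {0..L} \<subseteq> G \<and> \<gamma> 0 = x \<and> \<gamma> L = p0 \<and>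
        (\<forall>t\<in>{0..L}. c * t \<le> \<delta> (\<gamma> t))"
      by (elim exE)
    then have \<gamma>: "arc_length_parametrized \<gamma> L" "\<gamma> ` {0..L} \<subseteq> G" "\<gamma> 0 = x" "\<gamma> L = p0"
      "\<And>t. t \<in> {0..L} \<Longrightarrow> c * t \<le> \<delta> (\<gamma> t)"
      by simp_all
    have L: "0 \<le> L" using \<gamma>(1) by (simp add: arc_length_parametrized_def)
    \<comment> \<open>Geometric steps need a positive starting time; this one is the longest first
      move allowed by \<open>qh_joined_close_cubes\<close> at the centre x.\<close>
    define t where "t = \<delta> x / (20 * N)"
    have lt: "l / 20 \<le> t"
    proof -
      have "l / 20 = N * l / (20 * N)" using N by simp
      also have "\<dots> \<le> t" unfolding t_def using \<delta>_ge[OF x xc] N by (intro divide_right_mono) auto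
      finally show ?thesis .
    qed
    have lip: "dist x (\<gamma> s) \<le> s" if "0 \<le> s" "s \<le> L" for s
      using lipschitz_onD[OF arc_length_parametrized_lipschitz[OF \<gamma>(1)], of 0 s] that \<gamma>(3)
      by (auto simp: dist_real_def)
    show ?thesis
    proof (cases "L \<le> t")
      case True
      then have "dist x p0 \<le> \<delta> x / (20 * N)" using lip[of L] L \<gamma>(4) by (simp add: t_def)
      then have "qh_joined D M b b0"
        unfolding M_def by (rule qh_joined_close_cubes[OF x x0(1) xc x0(2) _ b x0(3)])
      moreover have "M \<le> A * ln (4 / l) + C"
        unfolding C_def using A M R l4 by (simp add: add_increasing)
      ultimately show ?thesis by (rule qh_joined_mono)
    next
      case False
      have t: "0 < t" "t \<le> L" using lt l False by auto
      then have "\<gamma> t \<in> G" using \<gamma>(2) by auto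
      then obtain x' l' where x': "whitney x' l'" "\<gamma> t \<in> cube x' l'" using mem_G_iff by blast
      define b' :: "real ^ 'n::{finite,linorder}" where "b' = (\<chi> i. x' $ i + l' / 2)"
      have b': "b' \<in> frontier (cube x' l')" using x'(1) by (simp add: b'_def frontier_cube mem_cube)
      have 1: "qh_joined D M b b'"
        unfolding M_def using lip[of t] t
        by (intro qh_joined_close_cubes[OF x x'(1) xc x'(2) _ b b']) (simp add: t_def)
      define m where "m = nat \<lceil>ln (L / t) / ln (1 + e)\<rceil>"
      have lne: "0 < ln (1 + e)" using e by simp
      have lnL: "0 \<le> ln (L / t)" using t by simp
      have m1: "ln (L / t) / ln (1 + e) \<le> real m" unfolding m_def by linarith
      have m2: "real m \<le> ln (L / t) / ln (1 + e) + 1"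
      proof -
        have "0 \<le> ln (L / t) / ln (1 + e)" using lnL lne by simp
        then show ?thesis unfolding m_def by linarith
      qed
      have "L / t \<le> (1 + e) ^ m"
      proof -
        have "ln (L / t) \<le> real m * ln (1 + e)" using m1 lne by (simp add: field_simps)
        also have "\<dots> = ln ((1 + e) ^ m)" using e by (simp add: ln_realpow)
        finally show ?thesis using t e by (subst (asm) ln_le_cancel_iff) auto
      qed
      then have "L \<le> t * (1 + e) ^ m" using t by (simp add: field_simps)
      then have 2: "qh_joined D (M * (real m + 1)) b' b0"
        unfolding M_def e_def using \<gamma>(4,5) x0(2)
        by (intro qh_joined_john_curve[OF \<gamma>(1,2) c(1) _ x0(1) _ x0(3) t _ x' b']) auto
      \<comment> \<open>For e \<le> 1 the quadratic bound for exp (e / 2) stays below 1 + e.\<close>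
      have "ln (1 + e) \<ge> e / 2"
      proof -
        have "exp (e / 2) \<le> 1 + e / 2 + (e / 2)\<^sup>2" using e by (intro exp_bound) auto
        moreover have "e * e \<le> e * 1" using e by (intro mult_left_mono) auto
        then have "(e / 2)\<^sup>2 \<le> e / 4" by (simp add: power2_eq_square)
        ultimately have "exp (e / 2) \<le> 1 + e" using e by linarith
        then show ?thesis using e by (subst ln_ge_iff) auto
      qed
      then have "ln (L / t) / ln (1 + e) \<le> ln (L / t) / (e / 2)"
        using lnL e lne by (intro divide_left_mono) auto
      also have "\<dots> = 2 / e * ln (L / t)" by simp
      also have "\<dots> \<le> 2 / e * (ln (4 / l) + ln R)"
      proof (rule mult_left_mono)
        have "c * L \<le> \<delta> p0" using \<gamma>(5)[of L] \<gamma>(4) L by simp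
        then have "L \<le> \<delta> p0 / c" using c by (simp add: field_simps)
        then have "L / t \<le> (\<delta> p0 / c) / (l / 20)"
          using lt l L by (intro frac_le) auto
        also have "\<dots> = (20 * \<delta> p0 / c) / l" by simp
        also have "\<dots> \<le> R / l" using l by (intro divide_right_mono) (auto simp: R_def)
        also have "\<dots> \<le> 4 / l * R" using l R by (simp add: field_simps)
        finally have "ln (L / t) \<le> ln (4 / l * R)" using t by (intro ln_mono) auto
        also have "\<dots> = ln (4 / l) + ln R" using l R by (intro ln_mult_pos) auto
        finally show "ln (L / t) \<le> ln (4 / l) + ln R" .
      qed (use e in simp)
      finally have "real m \<le> 2 / e * (ln (4 / l) + ln R) + 1" using m2 by linarith
      \<comment> \<open>The 3 counts the initial move, the last move and the rounding up of
        m.\<close>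
      then have "M * (real m + 2) \<le> M * (2 / e * (ln (4 / l) + ln R) + 3)"
        using M by (intro mult_left_mono) auto
      also have "\<dots> = A * ln (4 / l) + C" by (simp add: A_def C_def algebra_simps)
      finally have "M + M * (real m + 1) \<le> A * ln (4 / l) + C" by (simp add: algebra_simps)
      with qh_joined_trans[OF 1 2] show ?thesis by (rule qh_joined_mono)
    qed
  qed
  then show ?thesis unfolding A_eq by blast
qed

text \<open>A point escapes from its apartment and then follows the John curve. It remains to
  compare the coefficients of ln l and ln d.\<close>

lemma qh_boundary_condition_D:
  assumes c: "0 < c" "c \<le> 1" and p0: "p0 \<in> G" and john: "john_condition G p0 c"
    and \<beta>: "\<beta> \<le> c / (8000 * real CARD('n))"
  shows "qh_boundary_condition (\<beta> / 4) D"
proof -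
  obtain x0 l0 where x0: "whitney x0 l0" "p0 \<in> cube x0 l0" using mem_G_iff p0 by blast
  define b0 :: "real ^ 'n::{finite,linorder}" where "b0 = (\<chi> i. x0 $ i + l0 / 2)"
  have b0: "b0 \<in> frontier (cube x0 l0)" using x0(1) by (simp add: b0_def frontier_cube mem_cube)
  define A where "A = 8000 * real CARD('n) / c"
  obtain C where C: "\<And>x l b. whitney x l \<Longrightarrow> b \<in> frontier (cube x l) \<Longrightarrow> qh_joined D (A * ln (4 / l) + C) b b0"
    using qh_joined_john_center[OF c john x0 b0] unfolding A_def by blast
  have N: "1 \<le> N" by (rule N_ge_1)
  \<comment> \<open>The smallness of \<beta> relative to c enters here.\<close>
  have A: "A \<le> 1 / \<beta>"
    using \<beta> \<beta>_pos c card_ge_2 by (simp add: A_def field_simps)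
  have B: "2 * N + 1 \<le> 4 / \<beta>"
  proof -
    have "N * 1 \<le> N * N" using N by (intro mult_left_mono) auto
    then have "N \<le> real CARD('n)" by (simp add: N_eq)
    then have "2 * N + 1 \<le> 8000 * real CARD('n)" using N by linarith
    also have "\<dots> \<le> A" unfolding A_def using c by (simp add: field_simps)
    also have "\<dots> \<le> 1 / \<beta>" by (rule A)
    also have "\<dots> \<le> 4 / \<beta>" using \<beta>_pos by (simp add: field_simps)
    finally show ?thesis .
  qed
  define K where "K = 84 * N + 1 + 3 * ln 9 + 3 / \<beta> * ln 8 + 1 / \<beta> * ln 4 + 4 / \<beta> * ln (6 * N) + C"
  have joined: "qh_joined D (1 / (\<beta> / 4) * ln (1 / \<delta>\<^sub>D z) + K) z b0" if z: "z \<in> D" for z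
  proof -
    obtain x l where x: "whitney x l" "z \<in> cube x l" using mem_D_cube[OF z] by blast
    have l: "0 < l" "l \<le> 4" using x side_le_4 by auto
    define d where "d = \<delta>\<^sub>D z"
    have d: "0 < d" "d \<le> 5 * N * l"
      using \<delta>\<^sub>D_pos[OF z] \<delta>\<^sub>D_le_\<delta>[OF z] \<delta>_le[OF x] by (auto simp: d_def)
    obtain b where b: "b \<in> frontier (cube x l)"
      "qh_joined D (84 * N + 1 + 3 * (ln 9 + ln (8 / l) / \<beta>) + (2 * N + 1) * ln ((d + N * l) / d)) z b"
      using qh_joined_escape[OF x(1) z x(2)] unfolding d_def by blast
    have q: "qh_joined D (84 * N + 1 + 3 * (ln 9 + ln (8 / l) / \<beta>) + (2 * N + 1) * ln ((d + N * l) / d)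
        + (A * ln (4 / l) + C)) z b0"
      using qh_joined_trans[OF b(2) C[OF x(1) b(1)]] .
    have 1: "(2 * N + 1) * ln ((d + N * l) / d) \<le> 4 / \<beta> * (ln (6 * N) + ln l - ln d)"
    proof -
      \<comment> \<open>Nonnegativity of the logarithm allows its coefficient to be enlarged to 4 /
        \<beta>.\<close>
      have "0 \<le> ln ((d + N * l) / d)" using d l N by (intro ln_ge_zero) (simp add: field_simps)
      then have "(2 * N + 1) * ln ((d + N * l) / d) \<le> 4 / \<beta> * ln ((d + N * l) / d)"
        using B by (rule mult_right_mono[rotated])
      \<comment> \<open>The 6 is 5 + 1, from d \<le> 5 N l.\<close>
      also have "\<dots> \<le> 4 / \<beta> * ln (6 * N * l / d)"
        using \<beta>_pos d l N
        by (intro mult_left_mono ln_mono divide_right_mono) (auto intro!: divide_pos_pos add_pos_nonneg)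
      also have "ln (6 * N * l / d) = ln (6 * N) + ln l - ln d"
        using d l N by (simp add: ln_div ln_mult_pos)
      finally show ?thesis .
    qed
    have 2: "A * ln (4 / l) \<le> 1 / \<beta> * (ln 4 - ln l)"
    proof -
      have "A * ln (4 / l) \<le> 1 / \<beta> * ln (4 / l)" using A l by (intro mult_right_mono) auto
      then show ?thesis using l by (simp add: ln_div)
    qed
    have 3: "ln (8 / l) / \<beta> = 1 / \<beta> * (ln 8 - ln l)" using l by (simp add: ln_div)
    have 4: "1 / (\<beta> / 4) * ln (1 / d) = 4 / \<beta> * (- ln d)" using d by (simp add: ln_div)
    have "84 * N + 1 + 3 * (ln 9 + ln (8 / l) / \<beta>) + (2 * N + 1) * ln ((d + N * l) / d) + (A * ln (4 / l) + C)
       \<le> 84 * N + 1 + 3 * (ln 9 + 1 / \<beta> * (ln 8 - ln l)) + 4 / \<beta> * (ln (6 * N) + ln l - ln d)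
          + (1 / \<beta> * (ln 4 - ln l) + C)"
      unfolding 3 using 1 2 by linarith
    \<comment> \<open>The terms in ln l cancel: + 4 / \<beta> from the enlarged cone term, - 3 /
      \<beta> from the passage, - 1 / \<beta> from the John curve.\<close>
    also have "\<dots> = 1 / (\<beta> / 4) * ln (1 / d) + K"
      unfolding 4 K_def by (simp add: algebra_simps add_divide_distrib diff_divide_distrib)
    finally show ?thesis using q unfolding d_def by (auto elim: qh_joined_mono)
  qed
  have "connected D" using joined by (blast intro: connected_if_qh_joined)
  moreover have "b0 \<in> D" using frontier_cube_subset_D[OF x0(1)] b0 by blast
  ultimately show ?thesis
    unfolding qh_boundary_condition_def domain_def
    using open_D bounded_D \<beta>_pos \<beta>_le_1 qh_joined_imp_qh_dist_le[OF joined] by auto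
qed

end

theorem theorem4p15:
  assumes "CARD('n::{finite,linorder}) \<ge> 2"
  shows "\<exists>\<kappa>::real. 0 < \<kappa> \<and> \<kappa> < 1 \<and>
    (\<forall>(G :: (real ^ 'n::{finite,linorder}) set) W c\<^sub>J \<beta>.
       john_domain G \<and> diameter G \<le> 4 \<and> is_john_constant G c\<^sub>J \<and>
       whitney_decomposition G W \<and> 0 < \<beta> \<and> \<beta> \<le> \<kappa> * c\<^sub>J \<longrightarrow>
       qh_boundary_condition (\<beta> / 4) (beta_version \<beta> W))"
proof (intro exI[of _ "1 / (8000 * real CARD('n))"] conjI allI impI)
  \<comment> \<open>The witness is the reciprocal of the constant in
    \<open>qh_joined_john_center\<close>, so that 8000 n / c \<le> 1 / \<beta>.\<close>
  show "0 < 1 / (8000 * real CARD('n))" "1 / (8000 * real CARD('n)) < 1"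
    using assms by (auto simp: field_simps)
  fix G :: "(real ^ 'n::{finite,linorder}) set" and W c \<beta>
  assume *: "john_domain G \<and> diameter G \<le> 4 \<and> is_john_constant G c \<and>
       whitney_decomposition G W \<and> 0 < \<beta> \<and> \<beta> \<le> 1 / (8000 * real CARD('n)) * c"
  then obtain p0 where p0: "p0 \<in> G" "john_condition G p0 c" and c: "0 < c" "c \<le> 1"
    by (auto simp: is_john_constant_def)
  have \<beta>: "\<beta> \<le> c / (8000 * real CARD('n))" using * by simp
  also have "\<dots> \<le> 1" using c assms by (simp add: field_simps)
  finally have "\<beta> \<le> 1" .
  then interpret whitney_apartments G W \<beta> "sqrt (real CARD('n))"
    using * assms p0 by unfold_locales (auto simp: john_domain_def domain_def)
  show "qh_boundary_condition (\<beta> / 4) (beta_version \<beta> W)"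
    using c p0 \<beta> by (rule qh_boundary_condition_D)
qed

end
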